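(* There exist absolute constants $c,K>0$ such that the following holds. Let $C\in\mathbb{R}^{m\times n}$ be an arbitrary matrix whose columns satisfy $\|C^j\|_2\le 1$ for all $j\in[n]$, and let $R\in\mathbb{R}^{m\times n}$ be a random matrix with entries drawn i.i.d. from $\mathcal{N}(0,\sigma^2)$. If $n\le m\le 2^{c\sqrt{n}}$, then with probability at least $1-1/m^2$, \[\mathrm{disc}(C+R)\le K\left(\sqrt{\log n}+\sigma\sqrt{n\log(2m/n)}\right).\]
   Context: $C^j$ denotes the $j$-th column of $C$. For $A\in\mathbb{R}^{m\times n}$, $\mathrm{disc}(A)=\min_{x\in\{-1,1\}^n}\|Ax\|_\infty$. *)

theory Defs
  imports "HOL-Probability.Probability" "Jordan_Normal_Form.Matrix"
begin

no_notation vec_nth (infixl "$" 90)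

definition l2_norm :: "real vec \<Rightarrow> real" where
  "l2_norm v = L2_set (\<lambda>i. v $ i) {..<dim_vec v}"

text \<open>Inserting 0 only matters for the empty vector, whose norm is thereby 0.\<close>

definition linf_norm :: "real vec \<Rightarrow> real" where
  "linf_norm v = Max (insert 0 ((\<lambda>i. \<bar>v $ i\<bar>) ` {..<dim_vec v}))"

definition sign_vecs :: "nat \<Rightarrow> real vec set" where
  "sign_vecs n = {x \<in> carrier_vec n. \<forall>j<n. x $ j \<in> {-1, 1}}"

lemma sign_vecs_nonempty: "sign_vecs n \<noteq> {}"
proof -
  have "vec n (\<lambda>_. 1) \<in> sign_vecs n"
    by (simp add: sign_vecs_def)
  then show ?thesis by blast
qed

lemma finite_sign_vecs: "finite (sign_vecs n)"
proof -
  have "sign_vecs n \<subseteq> (\<lambda>f. vec n f) ` ({..<n} \<rightarrow>\<^sub>E {-1, 1})"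
  proof
    fix x assume x: "x \<in> sign_vecs n"
    have "x = vec n (restrict (\<lambda>j. x $ j) {..<n})"
      using x by (intro eq_vecI) (auto simp: sign_vecs_def)
    moreover have "restrict (\<lambda>j. x $ j) {..<n} \<in> {..<n} \<rightarrow>\<^sub>E {-1, 1}"
      using x by (auto simp: sign_vecs_def PiE_def Pi_def)
    ultimately show "x \<in> (\<lambda>f. vec n f) ` ({..<n} \<rightarrow>\<^sub>E {-1, 1})" by blast
  qed
  then show ?thesis
    by (rule finite_subset) (intro finite_imageI finite_PiE; simp)
qed

definition disc :: "real mat \<Rightarrow> real" where
  "disc A = Min ((\<lambda>x. linf_norm (A *\<^sub>v x)) ` sign_vecs (dim_col A))"

text \<open>
  The centred normal law with standard deviation \<open>\<sigma> \<ge> 0\<close>. The case \<open>\<sigma> = 0\<close> is the point mass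
  at 0; it is separate because \<open>normal_density 0 0\<close> is identically 0.
\<close>

definition centred_normal :: "real \<Rightarrow> real measure" where
  "centred_normal \<sigma> =
    (if \<sigma> = 0 then return borel 0 else density lborel (\<lambda>x. ennreal (normal_density 0 \<sigma> x)))"

lemma prob_space_centred_normal:
  assumes "0 \<le> \<sigma>"
  shows "prob_space (centred_normal \<sigma>)"
  using assms prob_space_normal_density[of \<sigma> 0] prob_space_return[of "0::real" borel]
  by (auto simp: centred_normal_def)

text \<open>
  The joint law of an \<open>m \<times> n\<close> array of independent entries: a sample \<open>\<omega>\<close> is a function on index
  pairs, and the random matrix itself is \<open>mat m n \<omega>\<close>. Working with the law, not with
  random variables on an arbitrary sample space, keeps constants quantified outside it from
  depending on the type of that space.
\<close>

definition gaussian_array :: "nat \<Rightarrow> nat \<Rightarrow> real \<Rightarrow> (nat \<times> nat \<Rightarrow> real) measure" where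
  "gaussian_array m n \<sigma> = PiM ({..<m} \<times> {..<n}) (\<lambda>_. centred_normal \<sigma>)"

lemma prob_space_gaussian_array:
  assumes "0 \<le> \<sigma>"
  shows "prob_space (gaussian_array m n \<sigma>)"
  unfolding gaussian_array_def
  by (rule prob_space_PiM) (rule prob_space_centred_normal[OF assms])

end

theory Submission
  imports Defs "HOL-Real_Asymp.Real_Asymp"
begin

text \<open>
  The core is deterministic: if the columns of \<open>C\<close> are short and every row of \<open>G\<close>
  has fourth powers summing to at most \<open>16 n\<close>, then one signing makes \<open>C x\<close> of order
  \<open>sqrt (ln n)\<close> and \<open>G x\<close> of order \<open>sqrt (n ln (2 m / n))\<close>. A row with coefficients
  \<open>\<mu>\<close> is measured at a fractional \<open>x\<close> by the square root of the expectation of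
  \<open>exp (\<mu> \<bullet> X)\<close> over independent signs \<open>X\<close> with mean \<open>x\<close>. The logarithm of the expectation is
  concave along lines and its square root has, in direction \<open>u\<close>, second derivative
  proportional to \<open>(g \<bullet> u)\<^sup>2 / 2 - \<Sum> (g j * u j)\<^sup>2\<close>; a trace argument makes a weighted sum of these
  negative in some direction orthogonal to any prescribed half-dimensional space. Hence a
  minimiser of the total potential over the fractional signings that keep the rows of \<open>C\<close> with
  much mass on the unfrozen coordinates at 0, and the row potentials of \<open>G\<close> below a threshold,
  has few unfrozen coordinates. Each phase divides their number by 256. By Cauchy-Schwarz the
  fourth-power bound makes the squared rows of \<open>G\<close> on \<open>n / 256^p\<close> unfrozen coordinates smaller
  by a factor \<open>16^p\<close>, so the discrepancies of the phases form a geometric series.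

  For \<open>m \<le> n\<^sup>2\<close> the rows of \<open>R / \<sigma>\<close> satisfy the fourth-power bound with high probability. For
  \<open>m > n\<^sup>2\<close> a signing that depends on \<open>C\<close> only suffices, by a union bound over the Gaussian rows.
  The case \<open>m = 1\<close> is void, and otherwise \<open>m \<le> 2 powr (c * sqrt n)\<close> forces \<open>n\<close> to be large.
\<close>

section \<open>Moment generating functions of independent signs\<close>

text \<open>The logarithm of the expectation of \<open>exp (\<mu> * X)\<close> for a random sign \<open>X\<close> with mean \<open>x\<close>.\<close>

definition log_mgf :: "real \<Rightarrow> real \<Rightarrow> real" where
  "log_mgf \<mu> x = ln (cosh \<mu> + x * sinh \<mu>)"

lemma cosh_plus_sinh_pos:
  fixes \<mu> x :: real
  assumes "\<bar>x\<bar> \<le> 1"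
  shows "0 < cosh \<mu> + x * sinh \<mu>"
proof -
  have eq: "cosh \<mu> + x * sinh \<mu> = (1 + x) / 2 * exp \<mu> + (1 - x) / 2 * exp (- \<mu>)"
    by (simp add: cosh_def sinh_def field_simps)
  show ?thesis
  proof (cases "x = -1")
    case True
    then show ?thesis unfolding eq by simp
  next
    case False
    then show ?thesis unfolding eq using assms
      by (intro add_pos_nonneg mult_pos_pos mult_nonneg_nonneg) auto
  qed
qed

lemma log_mgf_minus: "log_mgf (- \<mu>) x = log_mgf \<mu> (- x)"
  by (simp add: log_mgf_def)

text \<open>Jensen's inequality for \<open>exp\<close>, applied to a sign with mean
  \<open>x\<close>.\<close>

lemma log_mgf_ge:
  assumes "\<bar>x\<bar> \<le> 1"
  shows "\<mu> * x \<le> log_mgf \<mu> x"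
proof -
  have "exp (((1 - x) / 2) * (- \<mu>) + ((1 + x) / 2) * \<mu>)
      \<le> ((1 - x) / 2) * exp (- \<mu>) + ((1 + x) / 2) * exp \<mu>"
    using convex_onD[OF exp_convex, of "(1 + x) / 2" "- \<mu>" \<mu>] assms
    by (simp add: field_simps)
  moreover have "((1 - x) / 2) * (- \<mu>) + ((1 + x) / 2) * \<mu> = \<mu> * x"
    by (simp add: field_simps)
  moreover have "((1 - x) / 2) * exp (- \<mu>) + ((1 + x) / 2) * exp \<mu> = cosh \<mu> + x * sinh \<mu>"
    by (simp add: cosh_def sinh_def field_simps)
  ultimately have "exp (\<mu> * x) \<le> cosh \<mu> + x * sinh \<mu>" by simp
  then have "\<mu> * x \<le> ln (cosh \<mu> + x * sinh \<mu>)"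
    using cosh_plus_sinh_pos[OF assms, of \<mu>] by (subst ln_ge_iff) auto
  then show ?thesis by (simp add: log_mgf_def)
qed

text \<open>Hoeffding's lemma for a variable with values -1 and 1, an interval of length 2;
  \<open>p\<close> is the probability of the value 1. Negative \<open>\<mu>\<close> is reduced to
  positive by reflecting \<open>x\<close>.\<close>

lemma log_mgf_le:
  assumes "\<bar>x\<bar> \<le> 1"
  shows "log_mgf \<mu> x \<le> \<mu> * x + \<mu>\<^sup>2 / 2"
proof -
  have nonneg: "log_mgf \<mu> x \<le> \<mu> * x + \<mu>\<^sup>2 / 2" if "0 \<le> \<mu>" "\<bar>x\<bar> \<le> 1" for \<mu> x
  proof -
    define p where "p = (1 + x) / 2"
    have p: "0 \<le> p" using that by (simp add: p_def)
    have q: "0 < 1 + p * (exp (2 * \<mu>) - 1)"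
      using p that by (intro add_pos_nonneg) auto
    have e2: "exp (2 * \<mu>) = exp \<mu> * exp \<mu>" by (simp add: exp_add[symmetric])
    have "cosh \<mu> + x * sinh \<mu> = exp (- \<mu>) * (1 + p * (exp (2 * \<mu>) - 1))"
      unfolding e2 p_def by (simp add: cosh_def sinh_def exp_minus field_simps)
    then have "log_mgf \<mu> x = - \<mu> + ln (1 + p * (exp (2 * \<mu>) - 1))"
      using q by (simp add: log_mgf_def ln_mult)
    also have "\<dots> \<le> - \<mu> + (2 * \<mu> * p + (2 * \<mu>)\<^sup>2 / 8)"
      using Hoeffdings_lemma_aux[of "2 * \<mu>" p] p that by simp
    also have "\<dots> = \<mu> * x + \<mu>\<^sup>2 / 2" by (simp add: p_def power2_eq_square field_simps)
    finally show ?thesis .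
  qed
  show ?thesis
  proof (cases "0 \<le> \<mu>")
    case True then show ?thesis using nonneg assms by blast
  next
    case False
    then have "log_mgf (- \<mu>) (- x) \<le> (- \<mu>) * (- x) + (- \<mu>)\<^sup>2 / 2"
      using assms by (intro nonneg) auto
    then show ?thesis by (simp add: log_mgf_minus)
  qed
qed

text \<open>A frozen coordinate is deterministic and adds no variance term. This is why the squares
  in \<open>sqrt_mgf_le\<close> run over \<open>alive\<close> coordinates only.\<close>

lemma log_mgf_endpoint:
  assumes "\<bar>x\<bar> = 1"
  shows "log_mgf \<mu> x = \<mu> * x"
proof -
  consider "x = 1" | "x = -1" using assms by linarith
  then show ?thesis
    by cases (simp_all add: log_mgf_def cosh_plus_sinh cosh_minus_sinh)
qed

definition log_mgf_slope :: "real \<Rightarrow> real \<Rightarrow> real" where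
  "log_mgf_slope \<mu> x = sinh \<mu> / (cosh \<mu> + x * sinh \<mu>)"

lemma log_mgf_has_derivative:
  assumes "\<bar>x\<bar> \<le> 1"
  shows "(log_mgf \<mu> has_real_derivative log_mgf_slope \<mu> x) (at x)"
  unfolding log_mgf_def log_mgf_slope_def
  using cosh_plus_sinh_pos[OF assms, of \<mu>]
  by (auto intro!: derivative_eq_intros simp: divide_inverse)

text \<open>\<open>log_mgf\<close> is the logarithm of an affine function of \<open>x\<close>, so
  its second derivative is minus the square of its first. Hence the diagonal of the second-order
  form consists of squared gradient entries.\<close>

lemma log_mgf_slope_has_derivative:
  assumes "\<bar>x\<bar> \<le> 1"
  shows "(log_mgf_slope \<mu> has_real_derivative - (log_mgf_slope \<mu> x)\<^sup>2) (at x)"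
  unfolding log_mgf_slope_def
  using cosh_plus_sinh_pos[OF assms, of \<mu>]
  by (auto intro!: derivative_eq_intros simp: power2_eq_square)

text \<open>Concavity in global form, from \<open>ln z \<le> z - 1\<close> applied to the ratio of
  the two affine values.\<close>

lemma log_mgf_le_tangent:
  assumes "\<bar>x\<bar> \<le> 1" "\<bar>x + h\<bar> \<le> 1"
  shows "log_mgf \<mu> (x + h) \<le> log_mgf \<mu> x + h * log_mgf_slope \<mu> x"
proof -
  define F where "F = cosh \<mu> + x * sinh \<mu>"
  have F: "0 < F" using cosh_plus_sinh_pos[OF assms(1)] by (simp add: F_def)
  have G: "0 < cosh \<mu> + (x + h) * sinh \<mu>" using cosh_plus_sinh_pos[OF assms(2)] .
  have "log_mgf \<mu> (x + h) - log_mgf \<mu> x = ln ((cosh \<mu> + (x + h) * sinh \<mu>) / F)"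
    using F G by (simp add: log_mgf_def F_def ln_div)
  also have "\<dots> \<le> (cosh \<mu> + (x + h) * sinh \<mu>) / F - 1"
    using F G by (intro ln_le_minus_one) auto
  also have "\<dots> = h * log_mgf_slope \<mu> x"
    using F by (simp add: log_mgf_slope_def F_def[symmetric]) (simp add: F_def field_simps)
  finally show ?thesis by simp
qed

text \<open>At a local minimum the first derivative vanishes; being strictly decreasing at 0, it is
  then negative just to the right, where the mean value theorem makes the function fall.\<close>

lemma no_local_min_of_second_derivative_neg:
  fixes \<phi> \<phi>' :: "real \<Rightarrow> real"
  assumes "0 < r0" and \<phi>: "\<And>t. \<bar>t\<bar> < r0 \<Longrightarrow> (\<phi> has_real_derivative \<phi>' t) (at t)"
    and \<phi>': "(\<phi>' has_real_derivative D) (at 0)" and "D < 0" "0 < r"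
  shows "\<exists>t. \<bar>t\<bar> < r \<and> \<phi> t < \<phi> 0"
proof (rule ccontr)
  assume neg: "\<not> ?thesis"
  have ge: "\<phi> 0 \<le> \<phi> t" if "\<bar>t\<bar> < r" for t
    using neg that by force
  have "\<phi>' 0 = 0"
    using \<phi>[of 0] \<open>0 < r0\<close> \<open>0 < r\<close> ge by (intro DERIV_local_min[of \<phi> "\<phi>' 0" 0 r]) auto
  moreover obtain d where d: "0 < d" "\<And>h. 0 < h \<Longrightarrow> h < d \<Longrightarrow> \<phi>' (0 + h) < \<phi>' 0"
    using DERIV_neg_dec_right[OF \<phi>' \<open>D < 0\<close>] by blast
  define t where "t = min d (min r r0) / 2"
  have t: "0 < t" "t < d" "t < r" "t < r0"
    using d(1) assms(1,5) by (auto simp: t_def min_def)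
  obtain z where z: "0 < z" "z < t" "\<phi> t - \<phi> 0 = (t - 0) * \<phi>' z"
    using MVT2[of 0 t \<phi> \<phi>'] \<phi> t by (metis abs_of_nonneg le_less_trans)
  have "\<phi>' z < 0" using d(2)[of z] z t calculation by simp
  then have "\<phi> t < \<phi> 0" using z(3) t mult_pos_neg[of t "\<phi>' z"] by simp
  then show False using neg t by (metis abs_of_pos)
qed

text \<open>In the second derivative the root multiplies the diagonal terms by 1/2 but the squared gradient
  by 1/4, which is what lets the diagonal win.\<close>

definition sqrt_mgf :: "nat \<Rightarrow> (nat \<Rightarrow> real) \<Rightarrow> (nat \<Rightarrow> real) \<Rightarrow> real" where
  "sqrt_mgf n \<mu> x = exp ((\<Sum>j<n. log_mgf (\<mu> j) (x j)) / 2)"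

text \<open>Coordinates from \<open>n\<close> on are pinned to 0, so that the cube is a product of
  compact sets inside the full function space and Tychonoff's theorem applies.\<close>

definition cube :: "nat \<Rightarrow> (nat \<Rightarrow> real) set" where
  "cube n = {x. (\<forall>j<n. \<bar>x j\<bar> \<le> 1) \<and> (\<forall>j\<ge>n. x j = 0)}"

definition alive :: "nat \<Rightarrow> (nat \<Rightarrow> real) \<Rightarrow> nat set" where
  "alive n x = {j. j < n \<and> \<bar>x j\<bar> < 1}"

lemma sqrt_mgf_pos: "0 < sqrt_mgf n \<mu> x" by (simp add: sqrt_mgf_def)

lemma cubeD: "x \<in> cube n \<Longrightarrow> j < n \<Longrightarrow> \<bar>x j\<bar> \<le> 1"
  by (simp add: cube_def)

lemma finite_alive: "finite (alive n x)"
  by (simp add: alive_def)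

lemma sqrt_mgf_ge:
  assumes "x \<in> cube n"
  shows "exp ((\<Sum>j<n. \<mu> j * x j) / 2) \<le> sqrt_mgf n \<mu> x"
  unfolding sqrt_mgf_def using assms by (auto intro!: sum_mono log_mgf_ge simp: cubeD)

lemma sqrt_mgf_le:
  assumes "x \<in> cube n"
  shows "sqrt_mgf n \<mu> x \<le> exp ((\<Sum>j<n. \<mu> j * x j) / 2 + (\<Sum>j\<in>alive n x. (\<mu> j)\<^sup>2) / 4)"
proof -
  have "(\<Sum>j<n. log_mgf (\<mu> j) (x j))
      \<le> (\<Sum>j<n. \<mu> j * x j + (if j \<in> alive n x then (\<mu> j)\<^sup>2 / 2 else 0))"
  proof (intro sum_mono)
    fix j assume "j \<in> {..<n}"
    then have j: "\<bar>x j\<bar> \<le> 1" "j < n" using assms cubeD by auto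
    show "log_mgf (\<mu> j) (x j) \<le> \<mu> j * x j + (if j \<in> alive n x then (\<mu> j)\<^sup>2 / 2 else 0)"
    proof (cases "j \<in> alive n x")
      case True
      then show ?thesis using log_mgf_le[OF j(1)] by simp
    next
      case False
      then have "\<bar>x j\<bar> = 1" using j by (auto simp: alive_def)
      then show ?thesis using False by (simp add: log_mgf_endpoint)
    qed
  qed
  also have "\<dots> = (\<Sum>j<n. \<mu> j * x j) + (\<Sum>j\<in>alive n x. (\<mu> j)\<^sup>2) / 2"
  proof -
    have "alive n x \<subseteq> {..<n}" by (auto simp: alive_def)
    then have "(\<Sum>j<n. if j \<in> alive n x then (\<mu> j)\<^sup>2 / 2 else 0) = (\<Sum>j\<in>alive n x. (\<mu> j)\<^sup>2 / 2)"
      by (subst sum.mono_neutral_cong_right[of "{..<n}" "alive n x" _ "\<lambda>j. (\<mu> j)\<^sup>2 / 2"]) auto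
    then show ?thesis by (simp add: sum.distrib sum_divide_distrib)
  qed
  finally show ?thesis by (simp add: sqrt_mgf_def add_divide_distrib)
qed

section \<open>Potentials along a line that moves only unfrozen coordinates\<close>

context
  fixes n :: nat and y u :: "nat \<Rightarrow> real"
  assumes y: "y \<in> cube n" and u_alive: "\<And>j. j \<notin> alive n y \<Longrightarrow> u j = 0"
begin

lemma line_stays_in_cube: "\<exists>r>0. \<forall>t. \<bar>t\<bar> < r \<longrightarrow> (\<lambda>j. y j + t * u j) \<in> cube n"
proof -
  have "\<forall>\<^sub>F t in nhds 0. \<forall>j\<in>alive n y. \<bar>y j + t * u j\<bar> < 1"
  proof (intro eventually_ball_finite finite_alive ballI)
    fix j assume "j \<in> alive n y"
    then have "\<bar>y j + 0 * u j\<bar> < 1" by (simp add: alive_def)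
    moreover have "((\<lambda>t. \<bar>y j + t * u j\<bar>) \<longlongrightarrow> \<bar>y j + 0 * u j\<bar>) (nhds 0)"
      by (intro tendsto_intros filterlim_ident)
    ultimately show "\<forall>\<^sub>F t in nhds 0. \<bar>y j + t * u j\<bar> < 1"
      by (rule order_tendstoD(2)[rotated])
  qed
  then obtain r where r: "0 < r" "\<And>t. \<bar>t\<bar> < r \<Longrightarrow> \<forall>j\<in>alive n y. \<bar>y j + t * u j\<bar> < 1"
    by (auto simp: eventually_nhds_metric dist_real_def)
  have "(\<lambda>j. y j + t * u j) \<in> cube n" if "\<bar>t\<bar> < r" for t
  proof -
    have "\<bar>y j + t * u j\<bar> \<le> 1" if "j < n" for j
      using r(2)[OF \<open>\<bar>t\<bar> < r\<close>] u_alive[of j] cubeD[OF y that] less_imp_le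
      by (cases "j \<in> alive n y") auto
    moreover have "y j + t * u j = 0" if "j \<ge> n" for j
      using y u_alive[of j] that by (auto simp: cube_def alive_def)
    ultimately show ?thesis by (simp add: cube_def)
  qed
  then show ?thesis using r(1) by blast
qed

lemma sum_alive: "(\<Sum>j\<in>alive n y. f j * u j) = (\<Sum>j<n. f j * u j)"
  by (rule sum.mono_neutral_left) (auto simp: alive_def intro: u_alive[unfolded alive_def])

lemma sum_alive2: "(\<Sum>j\<in>alive n y. (f j * u j)\<^sup>2) = (\<Sum>j<n. (f j * u j)\<^sup>2)"
  by (rule sum.mono_neutral_left) (auto simp: alive_def intro: u_alive[unfolded alive_def])

text \<open>By concavity of the logarithm this holds for every \<open>t\<close> that stays in the
  cube, not just to second order, so a row that sits exactly at its threshold cannot cross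
  it.\<close>

lemma sqrt_mgf_nonincreasing_along_tangent:
  assumes "(\<Sum>j<n. log_mgf_slope (\<mu> j) (y j) * u j) = 0" "(\<lambda>j. y j + t * u j) \<in> cube n"
  shows "sqrt_mgf n \<mu> (\<lambda>j. y j + t * u j) \<le> sqrt_mgf n \<mu> y"
proof -
  have "(\<Sum>j<n. log_mgf (\<mu> j) (y j + t * u j))
      \<le> (\<Sum>j<n. log_mgf (\<mu> j) (y j) + t * u j * log_mgf_slope (\<mu> j) (y j))"
    using cubeD[OF y] cubeD[OF assms(2)] by (intro sum_mono log_mgf_le_tangent) auto
  also have "\<dots> = (\<Sum>j<n. log_mgf (\<mu> j) (y j)) + t * (\<Sum>j<n. log_mgf_slope (\<mu> j) (y j) * u j)"
    by (simp add: sum.distrib sum_distrib_left mult_ac)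
  finally show ?thesis using assms(1) by (simp add: sqrt_mgf_def)
qed

lemma sum_log_mgf_line_deriv:
  assumes "(\<lambda>j. y j + t * u j) \<in> cube n"
  shows "((\<lambda>t. \<Sum>j<n. log_mgf (\<mu> j) (y j + t * u j)) has_real_derivative
      (\<Sum>j<n. log_mgf_slope (\<mu> j) (y j + t * u j) * u j)) (at t)"
proof (intro DERIV_sum)
  fix j assume "j \<in> {..<n}"
  then have "(log_mgf (\<mu> j) has_real_derivative log_mgf_slope (\<mu> j) (y j + t * u j)) (at (y j + t * u j))"
    using cubeD[OF assms] by (intro log_mgf_has_derivative) auto
  then show "((\<lambda>t. log_mgf (\<mu> j) (y j + t * u j)) has_real_derivative
      log_mgf_slope (\<mu> j) (y j + t * u j) * u j) (at t)"
    by (rule DERIV_chain2) (auto intro!: derivative_eq_intros)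
qed

lemma isCont_sqrt_mgf_line: "isCont (\<lambda>t. sqrt_mgf n \<mu> (\<lambda>j. y j + t * u j)) 0"
proof -
  have "isCont (\<lambda>t. \<Sum>j<n. log_mgf (\<mu> j) (y j + t * u j)) 0"
    using sum_log_mgf_line_deriv[of 0 \<mu>] y by (intro DERIV_isCont) auto
  from isCont_o2[OF this, of "\<lambda>s. exp (s / 2)"] show ?thesis by (simp add: sqrt_mgf_def)
qed

lemma sum_slope_line_deriv:
  "((\<lambda>t. \<Sum>j<n. log_mgf_slope (\<mu> j) (y j + t * u j) * u j) has_real_derivative
      - (\<Sum>j<n. (log_mgf_slope (\<mu> j) (y j) * u j)\<^sup>2)) (at 0)"
proof -
  have "((\<lambda>t. log_mgf_slope (\<mu> j) (y j + t * u j) * u j) has_real_derivative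
      - (log_mgf_slope (\<mu> j) (y j) * u j)\<^sup>2) (at 0)" if "j < n" for j
  proof -
    have "(log_mgf_slope (\<mu> j) has_real_derivative - (log_mgf_slope (\<mu> j) (y j))\<^sup>2) (at (y j + 0 * u j))"
      using cubeD[OF y that] log_mgf_slope_has_derivative by simp
    then have "((\<lambda>t. log_mgf_slope (\<mu> j) (y j + t * u j)) has_real_derivative
        - (log_mgf_slope (\<mu> j) (y j))\<^sup>2 * u j) (at 0)"
      by (rule DERIV_chain2) (auto intro!: derivative_eq_intros)
    then show ?thesis
      by (rule DERIV_cong[OF DERIV_cmult_right]) (simp add: power2_eq_square)
  qed
  then have "((\<lambda>t. \<Sum>j<n. log_mgf_slope (\<mu> j) (y j + t * u j) * u j) has_real_derivative
      (\<Sum>j<n. - (log_mgf_slope (\<mu> j) (y j) * u j)\<^sup>2)) (at 0)"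
    by (intro DERIV_sum) auto
  then show ?thesis by (simp add: sum_negf)
qed

text \<open>Along the line, the second derivative of \<open>sqrt_mgf\<close> is
  \<open>sqrt_mgf\<close> times a quarter of the squared slope sum minus half the sum of squared
  slopes. The assumption \<open>dom\<close> balances the two up to a multiple of
  \<open>\<eta>\<close>, and the concave quadratic term in \<open>\<Psi>\<close> makes the total
  strictly negative.\<close>

lemma potential_decreases_along_line:
  fixes c :: "'q \<Rightarrow> real" and \<mu> :: "'q \<Rightarrow> nat \<Rightarrow> real"
  assumes "finite Q" and "0 < \<eta>" "0 < r" and nz: "\<exists>j. u j \<noteq> 0"
    and dom: "(\<Sum>q\<in>Q. c q * sqrt_mgf n (\<mu> q) y * (\<Sum>j<n. log_mgf_slope (\<mu> q j) (y j) * u j)\<^sup>2)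
      \<le> 2 * (\<Sum>q\<in>Q. c q * sqrt_mgf n (\<mu> q) y * (\<Sum>j<n. (log_mgf_slope (\<mu> q j) (y j) * u j)\<^sup>2))
        + 2 * \<eta> * (\<Sum>j<n. (u j)\<^sup>2)"
  defines "\<Psi> \<equiv> \<lambda>x. (\<Sum>q\<in>Q. c q * sqrt_mgf n (\<mu> q) x) - \<eta> * (\<Sum>j<n. (x j)\<^sup>2)"
  shows "\<exists>t. \<bar>t\<bar> < r \<and> \<Psi> (\<lambda>j. y j + t * u j) < \<Psi> y"
proof -
  define S where "S = (\<lambda>q t. \<Sum>j<n. log_mgf_slope (\<mu> q j) (y j + t * u j) * u j)"
  define \<phi>' where "\<phi>' = (\<lambda>t. (\<Sum>q\<in>Q. c q * (sqrt_mgf n (\<mu> q) (\<lambda>j. y j + t * u j) * (S q t / 2)))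
      - \<eta> * (\<Sum>j<n. 2 * (y j + t * u j) * u j))"
  define D where "D = (\<Sum>q\<in>Q. c q * (sqrt_mgf n (\<mu> q) y * ((S q 0)\<^sup>2 / 4 - (\<Sum>j<n. (log_mgf_slope (\<mu> q j) (y j) * u j)\<^sup>2) / 2)))
      - \<eta> * (\<Sum>j<n. 2 * (u j)\<^sup>2)"
  obtain r0 where r0: "0 < r0" "\<And>t. \<bar>t\<bar> < r0 \<Longrightarrow> (\<lambda>j. y j + t * u j) \<in> cube n"
    using line_stays_in_cube by blast
  have dW: "((\<lambda>t. sqrt_mgf n (\<mu> q) (\<lambda>j. y j + t * u j)) has_real_derivative
      sqrt_mgf n (\<mu> q) (\<lambda>j. y j + t * u j) * (S q t / 2)) (at t)" if "\<bar>t\<bar> < r0" for q t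
    unfolding sqrt_mgf_def S_def
    by (intro DERIV_fun_exp DERIV_cdivide sum_log_mgf_line_deriv r0 that)
  have d\<phi>: "((\<lambda>t. \<Psi> (\<lambda>j. y j + t * u j)) has_real_derivative \<phi>' t) (at t)" if "\<bar>t\<bar> < r0" for t
    unfolding \<Psi>_def \<phi>'_def
    by (intro DERIV_diff DERIV_sum DERIV_cmult dW that) (auto intro!: derivative_eq_intros)
  have d\<phi>': "(\<phi>' has_real_derivative D) (at 0)"
    unfolding \<phi>'_def D_def
  proof (intro DERIV_diff DERIV_sum DERIV_cmult)
    fix q
    have "((\<lambda>t. sqrt_mgf n (\<mu> q) (\<lambda>j. y j + t * u j) * (S q t / 2)) has_real_derivative
        sqrt_mgf n (\<mu> q) (\<lambda>j. y j + 0 * u j) * (S q 0 / 2) * (S q 0 / 2)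
        + - (\<Sum>j<n. (log_mgf_slope (\<mu> q j) (y j) * u j)\<^sup>2) / 2 * sqrt_mgf n (\<mu> q) (\<lambda>j. y j + 0 * u j)) (at 0)"
      using r0(1) sum_slope_line_deriv[of "\<mu> q"]
      by (intro DERIV_mult dW DERIV_cdivide) (simp_all add: S_def)
    then show "((\<lambda>t. sqrt_mgf n (\<mu> q) (\<lambda>j. y j + t * u j) * (S q t / 2)) has_real_derivative
        sqrt_mgf n (\<mu> q) y * ((S q 0)\<^sup>2 / 4 - (\<Sum>j<n. (log_mgf_slope (\<mu> q j) (y j) * u j)\<^sup>2) / 2)) (at 0)"
      by (rule DERIV_cong) (simp add: power2_eq_square field_simps)
  next
    fix j
    show "((\<lambda>t. 2 * (y j + t * u j) * u j) has_real_derivative 2 * (u j)\<^sup>2) (at 0)"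
      by (auto intro!: derivative_eq_intros simp: power2_eq_square)
  qed
  have "D < 0"
  proof -
    have "D = (\<Sum>q\<in>Q. c q * sqrt_mgf n (\<mu> q) y * (S q 0)\<^sup>2) / 4
        - (\<Sum>q\<in>Q. c q * sqrt_mgf n (\<mu> q) y * (\<Sum>j<n. (log_mgf_slope (\<mu> q j) (y j) * u j)\<^sup>2)) / 2
        - 2 * \<eta> * (\<Sum>j<n. (u j)\<^sup>2)"
      unfolding D_def
      by (simp add: right_diff_distrib sum_subtractf sum_divide_distrib sum_distrib_left mult.assoc
          mult.left_commute[of 2 \<eta>])
    \<comment> \<open>A quarter of \<open>dom\<close> leaves at most \<open>\<eta> / 2\<close> times
      the squared norm of \<open>u\<close>, against \<open>- 2 * \<eta>\<close> from the quadratic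
      term.\<close>
    also have "\<dots> \<le> - (3 / 2) * \<eta> * (\<Sum>j<n. (u j)\<^sup>2)"
      using dom by (simp add: S_def)
    also have "\<dots> < 0"
    proof -
      obtain k where k: "u k \<noteq> 0" using nz by blast
      then have "k < n" using u_alive[of k] by (auto simp: alive_def)
      then have "0 < (\<Sum>j<n. (u j)\<^sup>2)" using k by (intro sum_pos2[of _ k]) auto
      then show ?thesis using \<open>0 < \<eta>\<close> by simp
    qed
    finally show ?thesis .
  qed
  from no_local_min_of_second_derivative_neg[OF r0(1) d\<phi> d\<phi>' this \<open>0 < r\<close>]
  show ?thesis by simp
qed

end

section \<open>Directions on which a form is dominated by its diagonal\<close>

text \<open>Gaussian elimination: a pivot coordinate is removed together with its equation. The
  induction runs over a bound on the number of equations, as elimination may merge some of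
  them.\<close>

lemma homogeneous_system_nontrivial:
  fixes Z :: "('i \<Rightarrow> real) set"
  assumes "finite Z" "finite A" "card Z < card A"
  shows "\<exists>u. (\<exists>j\<in>A. u j \<noteq> 0) \<and> (\<forall>j. j \<notin> A \<longrightarrow> u j = 0) \<and> (\<forall>z\<in>Z. (\<Sum>j\<in>A. z j * u j) = 0)"
proof -
  have "\<exists>u. (\<exists>j\<in>A. u j \<noteq> 0) \<and> (\<forall>j. j \<notin> A \<longrightarrow> u j = 0) \<and> (\<forall>z\<in>Z. (\<Sum>j\<in>A. z j * u j) = 0)"
    if "finite Z" "finite A" "card Z \<le> p" "p < card A" for p and Z :: "('i \<Rightarrow> real) set" and A :: "'i set"
    using that
  proof (induction p arbitrary: Z A)
    case 0
    then have "Z = {}" by simp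
    moreover from 0 obtain k where "k \<in> A"
      by (metis card.empty ex_in_conv less_irrefl)
    ultimately show ?case
      by (intro exI[of _ "\<lambda>i. if i = k then 1 else 0"]) auto
  next
    case (Suc p)
    show ?case
    proof (cases "\<exists>z\<in>Z. \<exists>k\<in>A. z k \<noteq> 0")
      case False
      from Suc.prems obtain k where "k \<in> A"
        by (metis card.empty ex_in_conv less_zeroE)
      then show ?thesis using False
        by (intro exI[of _ "\<lambda>i. if i = k then 1 else 0"]) (auto intro!: sum.neutral)
    next
      case True
      then obtain z k where z: "z \<in> Z" and k: "k \<in> A" "z k \<noteq> 0" by blast
      define h where "h = (\<lambda>y j. y j - y k / z k * z j)"
      have "card (h ` (Z - {z})) \<le> p"
        using card_image_le[of "Z - {z}" h] Suc.prems(1,3) z by (simp add: card_Diff_singleton)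
      moreover have "p < card (A - {k})"
        using Suc.prems(2,4) k by (simp add: card_Diff_singleton)
      ultimately obtain u where u: "\<exists>j\<in>A - {k}. u j \<noteq> 0" "\<forall>j. j \<notin> A - {k} \<longrightarrow> u j = 0"
          "\<forall>y\<in>h ` (Z - {z}). (\<Sum>j\<in>A - {k}. y j * u j) = 0"
        using Suc.IH[of "h ` (Z - {z})" "A - {k}"] Suc.prems by auto
      define S where "S = (\<Sum>j\<in>A - {k}. z j * u j)"
      define v where "v = u(k := - S / z k)"
      have split: "(\<Sum>j\<in>A. y j * v j) = y k * v k + (\<Sum>j\<in>A - {k}. y j * u j)" for y
        using Suc.prems(2) k(1)
        by (subst sum.remove[of A k]) (auto simp: v_def intro!: sum.cong)
      have "(\<Sum>j\<in>A. y j * v j) = 0" if "y \<in> Z" for y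
      proof (cases "y = z")
        case True
        then show ?thesis using k(2) by (simp add: split S_def[symmetric]) (simp add: v_def)
      next
        case False
        then have "(\<Sum>j\<in>A - {k}. h y j * u j) = 0" using u(3) that by blast
        then have "(\<Sum>j\<in>A - {k}. y j * u j) = y k / z k * S"
          by (simp add: h_def S_def sum_subtractf sum_distrib_left algebra_simps)
        then show ?thesis using k(2) by (simp add: split) (simp add: v_def)
      qed
      moreover have "\<exists>j\<in>A. v j \<noteq> 0" using u(1) by (auto simp: v_def)
      moreover have "\<forall>j. j \<notin> A \<longrightarrow> v j = 0" using u(2) k by (auto simp: v_def)
      ultimately show ?thesis by blast
    qed
  qed
  from this[OF assms(1,2) order_refl assms(3)] show ?thesis .
qed

text \<open>Gram-Schmidt without projections: orthogonality to the earlier vectors is imposed as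
  further linear equations. For the next vector there are at most \<open>card Z + d\<close> of them,
  fewer than the coordinates in \<open>A\<close>.\<close>

lemma weighted_orthonormal_family:
  fixes D :: "'i \<Rightarrow> real"
  assumes "finite Z" "finite A" "card Z + d \<le> card A" and D: "\<And>j. j \<in> A \<Longrightarrow> 0 < D j"
  shows "\<exists>e :: nat \<Rightarrow> 'i \<Rightarrow> real. (\<forall>l<d. (\<forall>j. j \<notin> A \<longrightarrow> e l j = 0) \<and> (\<forall>z\<in>Z. (\<Sum>j\<in>A. z j * e l j) = 0))
    \<and> (\<forall>l<d. \<forall>l'<d. (\<Sum>j\<in>A. D j * e l j * e l' j) = (if l = l' then 1 else 0))"
  using assms(3)
proof (induction d)
  case 0
  then show ?case by simp
next
  case (Suc d)
  then obtain e :: "nat \<Rightarrow> 'i \<Rightarrow> real" where e0: "\<forall>l<d. (\<forall>j. j \<notin> A \<longrightarrow> e l j = 0) \<and> (\<forall>z\<in>Z. (\<Sum>j\<in>A. z j * e l j) = 0)"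
      "\<forall>l<d. \<forall>l'<d. (\<Sum>j\<in>A. D j * e l j * e l' j) = (if l = l' then 1 else 0)"
    using Suc_leD by fastforce
  have e: "\<And>l. l < d \<Longrightarrow> \<forall>j. j \<notin> A \<longrightarrow> e l j = 0"
      "\<And>l z. l < d \<Longrightarrow> z \<in> Z \<Longrightarrow> (\<Sum>j\<in>A. z j * e l j) = 0"
      "\<And>l l'. l < d \<Longrightarrow> l' < d \<Longrightarrow> (\<Sum>j\<in>A. D j * e l j * e l' j) = (if l = l' then 1 else 0)"
    using e0 by auto
  define Y where "Y = (\<lambda>l j. D j * e l j) ` {..<d}"
  have "card (Z \<union> Y) \<le> card Z + card Y" by (rule card_Un_le)
  also have "\<dots> \<le> card Z + d" unfolding Y_def using card_image_le[of "{..<d}" "\<lambda>l j. D j * e l j"] by simp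
  finally have "card (Z \<union> Y) < card A" using Suc.prems by simp
  then obtain u where u: "\<exists>j\<in>A. u j \<noteq> 0" "\<forall>j. j \<notin> A \<longrightarrow> u j = 0"
      "\<forall>z\<in>Z \<union> Y. (\<Sum>j\<in>A. z j * u j) = 0"
    using homogeneous_system_nontrivial[of "Z \<union> Y" A] assms(1,2) by (auto simp: Y_def)
  define s where "s = (\<Sum>j\<in>A. D j * (u j)\<^sup>2)"
  have s: "0 < s"
  proof -
    from u(1) obtain k where "k \<in> A" "u k \<noteq> 0" by blast
    then show ?thesis unfolding s_def
      using assms(2) D by (intro sum_pos2[of A k]) (auto simp: less_imp_le)
  qed
  define w where "w = (\<lambda>j. u j / sqrt s)"
  have ww: "(\<Sum>j\<in>A. D j * w j * w j) = 1"
  proof -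
    have "(\<Sum>j\<in>A. D j * w j * w j) = (\<Sum>j\<in>A. D j * (u j)\<^sup>2 / s)"
      using s by (intro sum.cong) (auto simp: w_def power2_eq_square)
    also have "\<dots> = 1" using s by (simp add: s_def sum_divide_distrib[symmetric])
    finally show ?thesis .
  qed
  have we: "(\<Sum>j\<in>A. D j * e l j * w j) = 0" if "l < d" for l
  proof -
    have "(\<Sum>j\<in>A. D j * e l j * u j) = 0" using u(3) that by (auto simp: Y_def)
    then show ?thesis by (simp add: w_def sum_divide_distrib[symmetric])
  qed
  have ew: "(\<Sum>j\<in>A. D j * w j * e l j) = 0" if "l < d" for l
    using we[OF that] by (simp add: mult_ac)
  have zw: "(\<Sum>j\<in>A. z j * w j) = 0" if "z \<in> Z" for z
    using u(3) that by (simp add: w_def sum_divide_distrib[symmetric])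
  have "\<forall>j. j \<notin> A \<longrightarrow> w j = 0" using u(2) by (simp add: w_def)
  then show ?case
    using e ww we ew zw
    by (intro exI[of _ "e(d := w)"]) (auto simp: less_Suc_eq)
qed

text \<open>Expand the weighted squared distance, which is nonnegative, from \<open>z\<close> to its
  projection onto the family.\<close>

lemma weighted_bessel:
  fixes D z :: "'i \<Rightarrow> real" and e :: "nat \<Rightarrow> 'i \<Rightarrow> real"
  assumes "finite A" and D: "\<And>j. j \<in> A \<Longrightarrow> 0 \<le> D j"
    and ortho: "\<And>l l'. l < d \<Longrightarrow> l' < d \<Longrightarrow> (\<Sum>j\<in>A. D j * e l j * e l' j) = (if l = l' then 1 else 0)"
  shows "(\<Sum>l<d. (\<Sum>j\<in>A. D j * z j * e l j)\<^sup>2) \<le> (\<Sum>j\<in>A. D j * (z j)\<^sup>2)"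
proof -
  define b where "b = (\<lambda>l. \<Sum>j\<in>A. D j * z j * e l j)"
  have "0 \<le> (\<Sum>j\<in>A. D j * (z j - (\<Sum>l<d. b l * e l j))\<^sup>2)"
    using D by (intro sum_nonneg) auto
  also have "\<dots> = (\<Sum>j\<in>A. D j * (z j)\<^sup>2 - 2 * (\<Sum>l<d. b l * (D j * z j * e l j))
      + (\<Sum>l<d. \<Sum>l'<d. b l * b l' * (D j * e l j * e l' j)))"
    by (intro sum.cong refl)
       (simp add: power2_eq_square algebra_simps sum_distrib_left sum_distrib_right sum_product)
  also have "\<dots> = (\<Sum>j\<in>A. D j * (z j)\<^sup>2) - 2 * (\<Sum>l<d. b l * (\<Sum>j\<in>A. D j * z j * e l j))
      + (\<Sum>l<d. \<Sum>l'<d. b l * b l' * (\<Sum>j\<in>A. D j * e l j * e l' j))"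
    by (simp add: sum.distrib sum_subtractf sum_distrib_left sum.swap[of _ _ A])
  also have "(\<Sum>l<d. \<Sum>l'<d. b l * b l' * (\<Sum>j\<in>A. D j * e l j * e l' j)) = (\<Sum>l<d. (b l)\<^sup>2)"
  proof (intro sum.cong refl)
    fix l assume "l \<in> {..<d}"
    then have "(\<Sum>l'<d. b l * b l' * (\<Sum>j\<in>A. D j * e l j * e l' j))
        = (\<Sum>l'<d. if l' = l then (b l)\<^sup>2 else 0)"
      by (intro sum.cong) (auto simp: ortho power2_eq_square)
    also have "\<dots> = (b l)\<^sup>2" using \<open>l \<in> {..<d}\<close> by simp
    finally show "(\<Sum>l'<d. b l * b l' * (\<Sum>j\<in>A. D j * e l j * e l' j)) = (b l)\<^sup>2" .
  qed
  also have "(\<Sum>l<d. b l * (\<Sum>j\<in>A. D j * z j * e l j)) = (\<Sum>l<d. (b l)\<^sup>2)"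
    by (simp add: b_def power2_eq_square)
  finally show ?thesis by (simp add: b_def)
qed

text \<open>
  Rescaled by its diagonal, the form on the left has trace at most \<open>card A\<close>, so on a
  subspace of at least half the dimension it takes a value at most 2 on some vector of an
  orthonormal basis.
\<close>

lemma exists_direction_dominated_by_diagonal:
  fixes g :: "'q \<Rightarrow> 'i \<Rightarrow> real" and c :: "'q \<Rightarrow> real"
  assumes "finite Z" "finite A" "A \<noteq> {}" "2 * card Z \<le> card A"
    and "finite Q" and c: "\<And>q. q \<in> Q \<Longrightarrow> 0 \<le> c q" and "0 < \<delta>"
  shows "\<exists>u. (\<exists>j\<in>A. u j \<noteq> 0) \<and> (\<forall>j. j \<notin> A \<longrightarrow> u j = 0) \<and> (\<forall>z\<in>Z. (\<Sum>j\<in>A. z j * u j) = 0)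
    \<and> (\<Sum>q\<in>Q. c q * (\<Sum>j\<in>A. g q j * u j)\<^sup>2)
      \<le> 2 * (\<Sum>q\<in>Q. c q * (\<Sum>j\<in>A. (g q j * u j)\<^sup>2)) + 2 * \<delta> * (\<Sum>j\<in>A. (u j)\<^sup>2)"
proof -
  \<comment> \<open>The summand \<open>\<delta>\<close> keeps the weighted inner product definite on
    coordinates where the diagonal vanishes.\<close>
  define D where "D = (\<lambda>j. (\<Sum>q\<in>Q. c q * (g q j)\<^sup>2) + \<delta>)"
  have D: "0 < D j" for j unfolding D_def
    using c \<open>0 < \<delta>\<close> by (intro add_nonneg_pos sum_nonneg) auto
  define d where "d = card A - card Z"
  have cardA: "0 < card A" using assms by (simp add: card_gt_0_iff)
  have d: "0 < d" "card A \<le> 2 * d" "card Z + d \<le> card A" using assms(4) cardA by (auto simp: d_def)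
  obtain e :: "nat \<Rightarrow> 'i \<Rightarrow> real" where e0: "\<forall>l<d. (\<forall>j. j \<notin> A \<longrightarrow> e l j = 0) \<and> (\<forall>z\<in>Z. (\<Sum>j\<in>A. z j * e l j) = 0)"
      "\<forall>l<d. \<forall>l'<d. (\<Sum>j\<in>A. D j * e l j * e l' j) = (if l = l' then 1 else 0)"
    using weighted_orthonormal_family[OF assms(1,2) d(3), of D] D by blast
  have e: "\<And>l. l < d \<Longrightarrow> \<forall>j. j \<notin> A \<longrightarrow> e l j = 0"
      "\<And>l z. l < d \<Longrightarrow> z \<in> Z \<Longrightarrow> (\<Sum>j\<in>A. z j * e l j) = 0"
      "\<And>l l'. l < d \<Longrightarrow> l' < d \<Longrightarrow> (\<Sum>j\<in>A. D j * e l j * e l' j) = (if l = l' then 1 else 0)"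
    using e0 by auto
  define F where "F = (\<lambda>l. \<Sum>q\<in>Q. c q * (\<Sum>j\<in>A. g q j * e l j)\<^sup>2)"
  \<comment> \<open>Multiplying and dividing by \<open>D j\<close> exhibits the sums as weighted
    coefficients of \<open>g q j / D j\<close>, ready for Bessel's inequality.\<close>
  have "(\<Sum>l<d. F l) = (\<Sum>q\<in>Q. c q * (\<Sum>l<d. (\<Sum>j\<in>A. D j * (g q j / D j) * e l j)\<^sup>2))"
    using D by (simp add: F_def sum.swap[of _ Q] sum_distrib_left less_imp_neq[THEN not_sym])
  also have "\<dots> \<le> (\<Sum>q\<in>Q. c q * (\<Sum>j\<in>A. D j * (g q j / D j)\<^sup>2))"
    by (intro sum_mono mult_left_mono c weighted_bessel[OF assms(2)] e(3) less_imp_le[OF D])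
  also have "\<dots> = (\<Sum>j\<in>A. (\<Sum>q\<in>Q. c q * (g q j)\<^sup>2) / D j)"
    using D by (simp add: sum.swap[of _ Q] sum_distrib_left sum_divide_distrib power2_eq_square
        less_imp_neq[THEN not_sym])
  \<comment> \<open>The numerator is \<open>D j - \<delta>\<close>, so each coordinate contributes
    at most 1 to the trace.\<close>
  also have "\<dots> \<le> (\<Sum>j\<in>A. 1)"
    using D \<open>0 < \<delta>\<close> by (intro sum_mono) (simp add: D_def[symmetric] divide_le_eq_1, simp add: D_def)
  finally have sumF: "(\<Sum>l<d. F l) \<le> 2 * real d" using d by simp
  have "\<exists>l<d. F l \<le> 2"
  proof (rule ccontr)
    assume "\<not> (\<exists>l<d. F l \<le> 2)"
    then have "(\<Sum>l<d. 2) < (\<Sum>l<d. F l)" using d by (intro sum_strict_mono) (auto simp: not_le)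
    then show False using sumF by simp
  qed
  then obtain l where l: "l < d" "F l \<le> 2" by blast
  have one: "(\<Sum>j\<in>A. D j * (e l j)\<^sup>2) = 1"
    using e(3)[of l l] l by (simp add: power2_eq_square mult.assoc)
  have "\<exists>j\<in>A. e l j \<noteq> 0"
  proof (rule ccontr)
    assume "\<not> (\<exists>j\<in>A. e l j \<noteq> 0)"
    then have "(\<Sum>j\<in>A. D j * (e l j)\<^sup>2) = 0" by (intro sum.neutral) auto
    then show False using one by simp
  qed
  moreover have "(\<Sum>j\<in>A. D j * (e l j)\<^sup>2)
      = (\<Sum>q\<in>Q. c q * (\<Sum>j\<in>A. (g q j * e l j)\<^sup>2)) + \<delta> * (\<Sum>j\<in>A. (e l j)\<^sup>2)"
    by (simp add: D_def distrib_right sum.distrib sum_distrib_left sum_distrib_right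
        sum.swap[of _ Q] power_mult_distrib mult.assoc)
  ultimately show ?thesis
    using l e one by (intro exI[of _ "e l"]) (auto simp: F_def)
qed

section \<open>The phases of the signing\<close>

lemma compact_cube: "compact (cube n)"
proof -
  define B where "B = (\<lambda>j. if j < n then {-1..1} else {0::real})"
  have "cube n = Pi\<^sub>E UNIV B"
    by (force simp: cube_def B_def PiE_UNIV_domain Pi_def abs_le_iff minus_le_iff split: if_splits)
  moreover have "compactin (product_topology (\<lambda>_. euclidean) UNIV) (Pi\<^sub>E UNIV B)"
    by (subst compactin_PiE) (auto simp: B_def)
  ultimately show ?thesis
    by (simp add: euclidean_product_topology)
qed

lemma closed_cube: "closed (cube n)"
proof -
  have "closed {x :: nat \<Rightarrow> real. \<bar>x j\<bar> \<le> 1}" for j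
    by (intro closed_Collect_le continuous_intros continuous_on_product_coordinates)
  moreover have "closed {x :: nat \<Rightarrow> real. x j = 0}" for j
    by (intro closed_Collect_eq continuous_intros continuous_on_product_coordinates)
  ultimately have "closed ((\<Inter>j\<in>{..<n}. {x :: nat \<Rightarrow> real. \<bar>x j\<bar> \<le> 1}) \<inter> (\<Inter>j\<in>{n..}. {x. x j = 0}))"
    by (intro closed_Int closed_INT ballI)
  moreover have "(\<Inter>j\<in>{..<n}. {x :: nat \<Rightarrow> real. \<bar>x j\<bar> \<le> 1}) \<inter> (\<Inter>j\<in>{n..}. {x. x j = 0}) = cube n"
    by (auto simp: cube_def)
  ultimately show ?thesis by simp
qed

lemma continuous_on_sqrt_mgf: "continuous_on (cube n) (sqrt_mgf n \<mu>)"
proof -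
  have "continuous_on (cube n) (\<lambda>x. log_mgf (\<mu> j) (x j))" if "j < n" for j
    unfolding log_mgf_def
    using cosh_plus_sinh_pos[OF cubeD[OF _ that]]
    by (intro continuous_intros continuous_on_subset[OF continuous_on_product_coordinates])
       (auto simp: less_imp_neq[THEN not_sym])
  then have "continuous_on (cube n) (\<lambda>x. exp ((\<Sum>j<n. log_mgf (\<mu> j) (x j)) / 2))"
    by (intro continuous_intros) auto
  then show ?thesis by (simp add: sqrt_mgf_def[abs_def])
qed

text \<open>This is the source of the geometric decay: by Cauchy-Schwarz the squared mass of a row
  on \<open>A\<close> shrinks with the square root of \<open>card A\<close>.\<close>

lemma sum_squares_le_of_sum_fourth_powers:
  fixes f :: "nat \<Rightarrow> real" and F :: real
  assumes "A \<subseteq> {..<n}" "(\<Sum>j<n. (f j)^4) \<le> F"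
  shows "(\<Sum>j\<in>A. (f j)\<^sup>2) \<le> sqrt (card A * F)"
proof (rule real_le_rsqrt)
  have "(\<Sum>j\<in>A. 1 * (f j)\<^sup>2)\<^sup>2 \<le> (\<Sum>j\<in>A. 1\<^sup>2) * (\<Sum>j\<in>A. ((f j)\<^sup>2)\<^sup>2)"
    by (rule Cauchy_Schwarz_ineq_sum)
  also have "(\<Sum>j\<in>A. ((f j)\<^sup>2)\<^sup>2) \<le> (\<Sum>j<n. (f j)^4)"
    using assms(1) by (simp add: power_mult[symmetric]) (intro sum_mono2, auto)
  also note assms(2)
  finally show "(\<Sum>j\<in>A. (f j)\<^sup>2)\<^sup>2 \<le> card A * F" by (simp add: mult_left_mono)
qed

section \<open>Signings for matrices with short columns\<close>

locale bounded_columns =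
  fixes n :: nat and I :: "'r set" and a :: "'r \<Rightarrow> nat \<Rightarrow> real" and \<kappa> :: real
  assumes finite_rows: "finite I"
    and column_le: "\<And>j. j < n \<Longrightarrow> (\<Sum>r\<in>I. (a r j)\<^sup>2) \<le> 1"
    and n_pos: "0 < n"
begin

text \<open>
  Rows in \<open>big A\<close> are kept orthogonal to the signing and enter the potential with a constant, which
  bounds their true contribution at the moment when they stop being big.
\<close>

definition big :: "nat set \<Rightarrow> 'r set" where
  "big A = {r\<in>I. 4 < (\<Sum>j\<in>A. (a r j)\<^sup>2)}"

definition orth :: "nat set \<Rightarrow> (nat \<Rightarrow> real) \<Rightarrow> bool" where
  "orth A x \<longleftrightarrow> (\<forall>r\<in>big A. (\<Sum>j<n. a r j * x j) = 0)"

text \<open>The weights sum to at most \<open>n\<close> however many rows there are, so the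
  normalised potential starts at most 1. A bound on it controls every row of weight at least
  \<open>1 / n\<close> up to a polynomial factor in \<open>n\<close>, which costs
  \<open>ln n\<close> and not the logarithm of the number of rows.\<close>

definition row_weight :: "'r \<Rightarrow> real" where
  "row_weight r = (\<Sum>j<n. (a r j)\<^sup>2)"

text \<open>The value of the bound in \<open>sqrt_mgf_le\<close> for a row with linear term 0 and
  alive mass 4, the threshold in \<open>big\<close>. The rate \<open>\<kappa>\<close> stays free
  until \<open>full_colouring\<close>.\<close>

definition row_cap :: real where "row_cap = exp (\<kappa>\<^sup>2)"

definition row_potential :: "'r \<Rightarrow> (nat \<Rightarrow> real) \<Rightarrow> real" where
  "row_potential r x = sqrt_mgf n (\<lambda>j. \<kappa> * a r j) x + sqrt_mgf n (\<lambda>j. - \<kappa> * a r j) x"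

definition potential :: "nat set \<Rightarrow> (nat \<Rightarrow> real) \<Rightarrow> real" where
  "potential A x = (\<Sum>r\<in>I. row_weight r * (if r \<in> big A then 2 * row_cap else row_potential r x)) / (2 * row_cap * n)"

lemma finite_big: "finite (big A)"
  using finite_rows by (simp add: big_def)

lemma big_mono: "finite B \<Longrightarrow> A \<subseteq> B \<Longrightarrow> big A \<subseteq> big B"
  unfolding big_def by (auto intro: less_le_trans[OF _ sum_mono2])

lemma orth_mono: "finite B \<Longrightarrow> A \<subseteq> B \<Longrightarrow> orth B x \<Longrightarrow> orth A x"
  using big_mono unfolding orth_def by blast

text \<open>Double counting: the columns in \<open>A\<close> carry total squared mass at most
  \<open>card A\<close>, and every big row holds more than 4 of it. Orthogonality thus uses at most
  a quarter of the dimensions.\<close>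

lemma card_big:
  assumes "A \<subseteq> {..<n}"
  shows "4 * card (big A) \<le> card A"
proof -
  have "real (4 * card (big A)) = (\<Sum>r\<in>big A. 4)" by simp
  also have "\<dots> \<le> (\<Sum>r\<in>big A. \<Sum>j\<in>A. (a r j)\<^sup>2)"
    by (intro sum_mono) (auto simp: big_def)
  also have "\<dots> \<le> (\<Sum>r\<in>I. \<Sum>j\<in>A. (a r j)\<^sup>2)"
    using finite_rows by (intro sum_mono2) (auto simp: big_def intro: sum_nonneg)
  also have "\<dots> = (\<Sum>j\<in>A. \<Sum>r\<in>I. (a r j)\<^sup>2)" by (rule sum.swap)
  also have "\<dots> \<le> (\<Sum>j\<in>A. 1)" using assms by (intro sum_mono column_le) auto
  finally show ?thesis by simp
qed

lemma row_weight_nonneg: "0 \<le> row_weight r"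
  by (simp add: row_weight_def sum_nonneg)

lemma sum_row_weight: "(\<Sum>r\<in>I. row_weight r) \<le> n"
proof -
  have "(\<Sum>r\<in>I. row_weight r) = (\<Sum>j<n. \<Sum>r\<in>I. (a r j)\<^sup>2)"
    unfolding row_weight_def by (rule sum.swap)
  also have "\<dots> \<le> (\<Sum>j<n. 1)" by (intro sum_mono column_le) auto
  finally show ?thesis by simp
qed

lemma row_cap_pos: "0 < row_cap" by (simp add: row_cap_def)

lemma row_potential_pos: "0 < row_potential r x" by (simp add: row_potential_def sqrt_mgf_pos add_pos_pos)

lemma potential_nonneg: "0 \<le> potential A x"
  unfolding potential_def using row_cap_pos
  by (intro divide_nonneg_nonneg sum_nonneg mult_nonneg_nonneg row_weight_nonneg)
     (auto simp: less_imp_le row_potential_pos)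

text \<open>A row that has just stopped being big is still orthogonal to the signing, so only the
  variance term of \<open>sqrt_mgf_le\<close> remains.\<close>

lemma row_potential_le:
  assumes "x \<in> cube n" "r \<in> I" "r \<notin> big (alive n x)" "(\<Sum>j<n. a r j * x j) = 0"
  shows "row_potential r x \<le> 2 * row_cap"
proof -
  have le: "sqrt_mgf n (\<lambda>j. s * a r j) x \<le> row_cap" if "s\<^sup>2 = \<kappa>\<^sup>2" for s
  proof -
    have "sqrt_mgf n (\<lambda>j. s * a r j) x
        \<le> exp (s * (\<Sum>j<n. a r j * x j) / 2 + \<kappa>\<^sup>2 * (\<Sum>j\<in>alive n x. (a r j)\<^sup>2) / 4)"
      using sqrt_mgf_le[OF assms(1), of "\<lambda>j. s * a r j"] that
      by (simp add: sum_distrib_left power_mult_distrib mult.assoc)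
    also have "\<dots> \<le> exp (\<kappa>\<^sup>2)"
    proof -
      have "(\<Sum>j\<in>alive n x. (a r j)\<^sup>2) \<le> 4" using assms(2,3) by (simp add: big_def)
      then have "\<kappa>\<^sup>2 * (\<Sum>j\<in>alive n x. (a r j)\<^sup>2) \<le> \<kappa>\<^sup>2 * 4" by (intro mult_left_mono) auto
      then show ?thesis using assms(4) by simp
    qed
    finally show ?thesis by (simp add: row_cap_def)
  qed
  show ?thesis using le[of \<kappa>] le[of "- \<kappa>"] by (simp add: row_potential_def)
qed

text \<open>When coordinates freeze, \<open>big\<close> can only shrink, and a row that leaves it
  trades the constant \<open>2 * row_cap\<close> for a true value that is no larger.\<close>

lemma potential_alive_le:
  assumes "x \<in> cube n" "finite A" "alive n x \<subseteq> A" "orth A x"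
  shows "potential (alive n x) x \<le> potential A x"
proof -
  have "(if r \<in> big (alive n x) then 2 * row_cap else row_potential r x) \<le> (if r \<in> big A then 2 * row_cap else row_potential r x)"
    if "r \<in> I" for r
    using row_potential_le[OF assms(1) that] assms(4) big_mono[OF assms(2,3)] by (auto simp: orth_def)
  then show ?thesis unfolding potential_def using row_cap_pos
    by (intro divide_right_mono sum_mono mult_left_mono row_weight_nonneg) auto
qed

lemma potential_zero: "potential (alive n (\<lambda>_. 0)) (\<lambda>_. 0) \<le> 1"
proof -
  have "(if r \<in> big (alive n (\<lambda>_. 0)) then 2 * row_cap else row_potential r (\<lambda>_. 0)) \<le> 2 * row_cap" if "r \<in> I" for r
    using row_potential_le[of "\<lambda>_. 0" r] that by (auto simp: cube_def)
  then have "(\<Sum>r\<in>I. row_weight r * (if r \<in> big (alive n (\<lambda>_. 0)) then 2 * row_cap else row_potential r (\<lambda>_. 0)))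
      \<le> (\<Sum>r\<in>I. row_weight r * (2 * row_cap))"
    by (intro sum_mono mult_left_mono row_weight_nonneg) auto
  also have "\<dots> = 2 * row_cap * (\<Sum>r\<in>I. row_weight r)" by (simp add: sum_distrib_left mult_ac)
  also have "\<dots> \<le> 2 * row_cap * n" using sum_row_weight row_cap_pos by (intro mult_left_mono) auto
  finally show ?thesis unfolding potential_def using row_cap_pos n_pos by (simp add: divide_le_eq_1)
qed

lemma continuous_on_potential: "continuous_on (cube n) (potential A)"
proof -
  have "continuous_on (cube n) (\<lambda>x. row_weight r * (if r \<in> big A then 2 * row_cap else row_potential r x))" for r
    unfolding row_potential_def by (cases "r \<in> big A") (auto intro!: continuous_intros continuous_on_sqrt_mgf)
  then have "continuous_on (cube n)
      (\<lambda>x. (\<Sum>r\<in>I. row_weight r * (if r \<in> big A then 2 * row_cap else row_potential r x)) / (2 * row_cap * n))"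
    using row_cap_pos n_pos by (intro continuous_on_divide continuous_on_sum continuous_on_const) auto
  then show ?thesis by (simp add: potential_def[abs_def])
qed

text \<open>Two nested minimisations: a good point with fewest alive coordinates, then a minimiser
  of \<open>\<Psi>\<close> over the feasible points with the same frozen coordinates. The minimiser
  cannot have frozen anything further, so it is interior to its face, and too many alive coordinates
  would leave a feasible direction in which \<open>\<Psi>\<close> decreases.\<close>

lemma discrepancy_phase:
  fixes J :: "'i set" and b :: "'i \<Rightarrow> nat \<Rightarrow> real" and N l \<tau> g :: real
  assumes J: "finite J" "J \<noteq> {}"
    and x0: "x0 \<in> cube n" "orth (alive n x0) x0" "potential (alive n x0) x0 \<le> g"
    and b: "\<And>i. i \<in> J \<Longrightarrow> (\<Sum>j\<in>alive n x0. (b i j)\<^sup>2) \<le> 4 * l"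
    and \<tau>: "exp l \<le> \<tau>" "(g + 2) * (2 * card J * exp l) \<le> \<tau> * N / 1024"
  shows "\<exists>x\<in>cube n. alive n x \<subseteq> alive n x0 \<and> card (alive n x) \<le> N / 256
    \<and> orth (alive n x) x \<and> potential (alive n x) x \<le> g + 2
    \<and> (\<forall>i\<in>J. \<bar>\<Sum>j<n. b i j * (x j - x0 j)\<bar> \<le> 2 * ln \<tau>)"
proof -
  define K where "K = J \<times> {1, -1::real}"
  define \<beta> where "\<beta> = (\<lambda>k j. snd k * b (fst k) j)"
  \<comment> \<open>This factor cancels the linear term at \<open>x0\<close>, so that
    \<open>V\<close> measures only the discrepancy gained within the phase.\<close>
  define v where "v = (\<lambda>k. exp (- (\<Sum>j<n. \<beta> k j * x0 j) / 2))"
  define V where "V = (\<lambda>k x. v k * sqrt_mgf n (\<beta> k) x)"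
  \<comment> \<open>With \<open>\<alpha>\<close> the total of \<open>V\<close> starts at most 1, and
    with \<open>\<eta>\<close> the quadratic term lies between 0 and 1; together they account for
    the increase from \<open>g\<close> to \<open>g + 2\<close>.\<close>
  define \<alpha> where "\<alpha> = 1 / (2 * card J * exp l)"
  define \<eta> where "\<eta> = 1 / real n"
  define \<Psi> where "\<Psi> = (\<lambda>A x. potential A x + \<alpha> * (\<Sum>k\<in>K. V k x) - \<eta> * (\<Sum>j<n. (x j)\<^sup>2))"
  define good where "good = (\<lambda>x. x \<in> cube n \<and> alive n x \<subseteq> alive n x0 \<and> orth (alive n x) x
    \<and> \<Psi> (alive n x) x \<le> g + 1 \<and> (\<forall>k\<in>K. V k x \<le> \<tau>))"
  have finK: "finite K" using J by (simp add: K_def)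
  have cardK: "card K = 2 * card J" by (simp add: K_def card_cartesian_product)
  have cardJ: "0 < card J" using J by (simp add: card_gt_0_iff)
  have \<alpha>: "0 < \<alpha>" using cardJ by (simp add: \<alpha>_def)
  have \<eta>: "0 < \<eta>" using n_pos by (simp add: \<eta>_def)
  have \<tau>_pos: "0 < \<tau>" using \<tau>(1) exp_gt_zero less_le_trans by blast
  have V_pos: "0 < V k x" for k x by (simp add: V_def v_def sqrt_mgf_pos)
  have \<eta>_sum: "\<eta> * (\<Sum>j<n. (x j)\<^sup>2) \<le> 1" if "x \<in> cube n" for x
  proof -
    have "(\<Sum>j<n. (x j)\<^sup>2) \<le> (\<Sum>j<n. 1)"
      using cubeD[OF that] by (intro sum_mono) (simp add: abs_square_le_1)
    then show ?thesis using n_pos by (simp add: \<eta>_def)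
  qed
  have V_x0: "V k x0 \<le> exp l" if "k \<in> K" for k
  proof -
    have "V k x0 \<le> v k * exp ((\<Sum>j<n. \<beta> k j * x0 j) / 2 + (\<Sum>j\<in>alive n x0. (\<beta> k j)\<^sup>2) / 4)"
      unfolding V_def by (intro mult_left_mono sqrt_mgf_le x0) (simp add: v_def)
    also have "\<dots> = exp ((\<Sum>j\<in>alive n x0. (\<beta> k j)\<^sup>2) / 4)"
      by (simp add: v_def exp_add[symmetric])
    also have "(\<Sum>j\<in>alive n x0. (\<beta> k j)\<^sup>2) = (\<Sum>j\<in>alive n x0. (b (fst k) j)\<^sup>2)"
      using that by (intro sum.cong) (auto simp: K_def \<beta>_def)
    also have "exp (\<dots> / 4) \<le> exp l" using b[of "fst k"] that by (auto simp: K_def)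
    finally show ?thesis .
  qed
  have good_x0: "good x0"
  proof -
    have "(\<Sum>k\<in>K. V k x0) \<le> (\<Sum>k\<in>K. exp l)" by (intro sum_mono V_x0)
    also have "\<dots> = 2 * card J * exp l" by (simp add: cardK)
    finally have "\<alpha> * (\<Sum>k\<in>K. V k x0) \<le> 1"
      using cardJ by (simp add: \<alpha>_def)
    moreover have "0 \<le> \<eta> * (\<Sum>j<n. (x0 j)\<^sup>2)" using \<eta> by (simp add: sum_nonneg)
    ultimately have "\<Psi> (alive n x0) x0 \<le> g + 1" using x0(3) by (simp add: \<Psi>_def)
    then show ?thesis using x0 V_x0 \<tau>(1) by (force simp: good_def)
  qed
  obtain x where x: "good x" and x_min: "\<And>y. good y \<Longrightarrow> card (alive n x) \<le> card (alive n y)"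
    using ex_has_least_nat[of good x0 "\<lambda>x. card (alive n x)"] good_x0 by blast
  define A where "A = alive n x"
  \<comment> \<open>The big rows are fixed at those of \<open>A\<close> here, so the constraints are
    closed and do not change as \<open>y\<close> varies.\<close>
  define F where "F = {y \<in> cube n. (\<forall>j\<in>-A. y j = x j) \<and> orth A y \<and> (\<forall>k\<in>K. V k y \<le> \<tau>)}"
  have A: "finite A" "A \<subseteq> {..<n}" by (auto simp: A_def alive_def)
  have xF: "x \<in> F" using x by (simp add: F_def good_def A_def)
  have cont_V: "continuous_on (cube n) (V k)" for k
    unfolding V_def by (intro continuous_intros continuous_on_sqrt_mgf)
  have cont_\<Psi>: "continuous_on (cube n) (\<Psi> A)"
    unfolding \<Psi>_def
    by (intro continuous_intros continuous_on_potential cont_V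
        continuous_on_subset[OF continuous_on_product_coordinates]) auto
  have "compact F"
  proof -
    have "closed {y \<in> cube n. V k y \<le> \<tau>}" for k
      by (intro continuous_on_closed_Collect_le closed_cube cont_V continuous_on_const)
    moreover have "closed {y :: nat \<Rightarrow> real. y j = x j}" for j
      by (intro closed_Collect_eq continuous_intros continuous_on_product_coordinates)
    moreover have "closed {y :: nat \<Rightarrow> real. (\<Sum>j<n. a r j * y j) = 0}" for r
      by (intro closed_Collect_eq continuous_intros continuous_on_product_coordinates)
    ultimately have "closed ((\<Inter>k\<in>K. {y \<in> cube n. V k y \<le> \<tau>}) \<inter> (\<Inter>j\<in>-A. {y. y j = x j})
        \<inter> (\<Inter>r\<in>big A. {y. (\<Sum>j<n. a r j * y j) = 0}))"
      by (intro closed_Int closed_INT ballI)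
    from compact_Int_closed[OF compact_cube this, of n] show ?thesis
      by (rule back_subst[of compact]) (auto simp: F_def orth_def)
  qed
  then obtain y where yF: "y \<in> F" and y_min: "\<And>z. z \<in> F \<Longrightarrow> \<Psi> A y \<le> \<Psi> A z"
    using continuous_attains_inf[of F "\<Psi> A"] xF continuous_on_subset[OF cont_\<Psi>, of F]
    by (auto simp: F_def)
  have y: "y \<in> cube n" "\<And>j. j \<notin> A \<Longrightarrow> y j = x j" "orth A y" "\<And>k. k \<in> K \<Longrightarrow> V k y \<le> \<tau>"
    using yF by (auto simp: F_def)
  have alive_y_sub: "alive n y \<subseteq> A"
    using y(2) by (force simp: A_def alive_def)
  have good_y: "good y"
  proof -
    have "\<Psi> (alive n y) y \<le> \<Psi> A y"
      using potential_alive_le[OF y(1) A(1) alive_y_sub y(3)] by (simp add: \<Psi>_def)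
    also have "\<dots> \<le> \<Psi> A x" by (rule y_min[OF xF])
    also have "\<dots> \<le> g + 1" using x by (simp add: good_def A_def)
    finally show ?thesis
      using y alive_y_sub x orth_mono[OF A(1) alive_y_sub y(3)] by (auto simp: good_def A_def)
  qed
  \<comment> \<open>By the minimal choice of \<open>x\<close> no coordinate of \<open>A\<close>
    reached the boundary, so \<open>y\<close> can move both ways along each of them.\<close>
  have alive_y: "alive n y = A"
    using x_min[OF good_y] alive_y_sub A(1) by (simp add: A_def card_seteq)
  have total: "potential A y + \<alpha> * (\<Sum>k\<in>K. V k y) \<le> g + 2"
    using good_y \<eta>_sum[OF y(1)] by (simp add: good_def \<Psi>_def alive_y)
  have few: "card A \<le> N / 256"
  proof (rule ccontr)
    assume "\<not> card A \<le> N / 256"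
    then have many: "N / 256 < card A" by simp
    \<comment> \<open>Rows at the threshold are frozen to first order; concavity then keeps them below it.\<close>
    define tight where "tight = {k\<in>K. V k y = \<tau>}"
    have fin_tight: "finite tight" using finK by (simp add: tight_def)
    \<comment> \<open>Markov's inequality: each tight row takes \<open>\<alpha> * \<tau>\<close> of
      a total of at most \<open>g + 2\<close>.\<close>
    have "card tight * (\<alpha> * \<tau>) = \<alpha> * (\<Sum>k\<in>tight. V k y)"
      by (simp add: tight_def)
    also have "\<dots> \<le> \<alpha> * (\<Sum>k\<in>K. V k y)"
      using \<alpha> V_pos finK by (intro mult_left_mono sum_mono2) (auto simp: tight_def less_imp_le)
    also have "\<dots> \<le> g + 2" using total potential_nonneg[of A y] by simp
    also have "\<dots> \<le> \<alpha> * \<tau> * (N / 1024)"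
      using \<tau>(2) cardJ by (simp add: \<alpha>_def field_simps)
    finally have "card tight \<le> N / 1024"
      using \<alpha> \<tau>_pos by (simp add: mult.commute mult_le_cancel_left_pos)
    then have four_tight: "4 * real (card tight) < card A" using many by simp
    define Q :: "('r \<times> real + 'i \<times> real) set" where "Q = (I \<times> {1, -1}) <+> K"
    define \<mu> where "\<mu> = case_sum (\<lambda>(r, s) j. s * \<kappa> * a r j) \<beta>"
    \<comment> \<open>Big rows get coefficient 0: what they add to \<open>\<Psi>\<close> does not
      depend on the point and is split off as \<open>C0\<close>.\<close>
    define c :: "('r \<times> real + 'i \<times> real) \<Rightarrow> real" where "c = case_sum (\<lambda>(r, s). if r \<in> big A then 0 else row_weight r / (2 * row_cap * n))
      (\<lambda>k. \<alpha> * v k)"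
    define C0 where "C0 = (\<Sum>r\<in>big A. row_weight r / n)"
    have finQ: "finite Q" using finK finite_rows by (simp add: Q_def)
    have c_nonneg: "0 \<le> c q" for q
      using \<alpha> row_cap_pos row_weight_nonneg by (auto simp: c_def v_def split: sum.split)
    have \<Psi>_eq: "\<Psi> A z = C0 + ((\<Sum>q\<in>Q. c q * sqrt_mgf n (\<mu> q) z) - \<eta> * (\<Sum>j<n. (z j)\<^sup>2))" for z
    proof -
      have "(\<Sum>q\<in>I \<times> {1, -1::real}. c (Inl q) * sqrt_mgf n (\<mu> (Inl q)) z)
          = (\<Sum>r\<in>I. if r \<in> big A then 0 else row_weight r / (2 * row_cap * n) * row_potential r z)"
        unfolding sum.cartesian_product'
        by (intro sum.cong refl) (simp add: c_def \<mu>_def row_potential_def distrib_left)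
      moreover have "potential A z = (\<Sum>r\<in>I. if r \<in> big A then row_weight r / n else row_weight r / (2 * row_cap * n) * row_potential r z)"
        unfolding potential_def sum_divide_distrib using row_cap_pos by (intro sum.cong) auto
      moreover have "\<dots> = C0 + (\<Sum>r\<in>I. if r \<in> big A then 0 else row_weight r / (2 * row_cap * n) * row_potential r z)"
      proof -
        have "C0 = (\<Sum>r\<in>I. if r \<in> big A then row_weight r / n else 0)"
          unfolding C0_def using finite_rows
          by (intro sum.mono_neutral_cong_left) (auto simp: big_def)
        then show ?thesis by (simp add: sum.distrib[symmetric]) (intro sum.cong, auto)
      qed
      moreover have "(\<Sum>k\<in>K. c (Inr k) * sqrt_mgf n (\<mu> (Inr k)) z) = \<alpha> * (\<Sum>k\<in>K. V k z)"
        by (simp add: c_def \<mu>_def V_def sum_distrib_left mult.assoc)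
      ultimately show ?thesis
        using finite_rows finK by (simp add: \<Psi>_def Q_def sum.Plus)
    qed
    define slope where "slope = (\<lambda>\<nu> j. log_mgf_slope (\<nu> j) (y j))"
    \<comment> \<open>Big rows and tight rows each give at most \<open>card A / 4\<close> equations,
      which leaves half of the dimensions.\<close>
    define Z where "Z = a ` big A \<union> (\<lambda>k. slope (\<beta> k)) ` tight"
    have "A \<noteq> {}"
      using four_tight by auto
    have "card Z \<le> card (big A) + card tight"
      unfolding Z_def using card_Un_le card_image_le[OF finite_big] card_image_le[OF fin_tight]
      by (meson add_mono le_trans)
    then have cardZ: "2 * card Z \<le> card A"
      using card_big[OF A(2)] four_tight by linarith
    have finZ: "finite Z" using finite_big fin_tight by (simp add: Z_def)
    obtain u where u: "\<exists>j\<in>A. u j \<noteq> 0" "\<forall>j. j \<notin> A \<longrightarrow> u j = 0" "\<forall>z\<in>Z. (\<Sum>j\<in>A. z j * u j) = 0"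
      and u_dom: "(\<Sum>q\<in>Q. c q * sqrt_mgf n (\<mu> q) y * (\<Sum>j\<in>A. slope (\<mu> q) j * u j)\<^sup>2)
        \<le> 2 * (\<Sum>q\<in>Q. c q * sqrt_mgf n (\<mu> q) y * (\<Sum>j\<in>A. (slope (\<mu> q) j * u j)\<^sup>2)) + 2 * \<eta> * (\<Sum>j\<in>A. (u j)\<^sup>2)"
      using exists_direction_dominated_by_diagonal[OF finZ A(1) \<open>A \<noteq> {}\<close> cardZ finQ _ \<eta>,
          of "\<lambda>q. c q * sqrt_mgf n (\<mu> q) y" "\<lambda>q. slope (\<mu> q)"] c_nonneg sqrt_mgf_pos
      by (auto simp: less_imp_le)
    have u_alive: "u j = 0" if "j \<notin> alive n y" for j using u(2) that by (simp add: alive_y)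
    have sumA: "(\<Sum>j\<in>A. f j * u j) = (\<Sum>j<n. f j * u j)"
      and sumA2: "(\<Sum>j\<in>A. (f j * u j)\<^sup>2) = (\<Sum>j<n. (f j * u j)\<^sup>2)" for f
      using sum_alive[OF y(1), of u f] sum_alive2[OF y(1), of u f] u_alive by (simp_all add: alive_y)
    have sumA_sq: "(\<Sum>j\<in>A. (u j)\<^sup>2) = (\<Sum>j<n. (u j)\<^sup>2)"
      using sumA2[of "\<lambda>_. 1"] by simp
    have kill_big: "(\<Sum>j<n. a r j * u j) = 0" if "r \<in> big A" for r
      using u(3) that unfolding sumA[symmetric] by (auto simp: Z_def)
    have kill_tight: "(\<Sum>j<n. log_mgf_slope (\<beta> k j) (y j) * u j) = 0" if "k \<in> tight" for k
      using u(3) that unfolding sumA[symmetric] by (auto simp: Z_def slope_def)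
    define ln_y where "ln_y = (\<lambda>t j. y j + t * u j)"
    obtain r0 where r0: "0 < r0" "\<And>t. \<bar>t\<bar> < r0 \<Longrightarrow> ln_y t \<in> cube n"
      using line_stays_in_cube[where u = u, OF y(1) u_alive] by (auto simp: ln_y_def)
    \<comment> \<open>The rows strictly below the threshold stay there near \<open>y\<close> by
      continuity, uniformly because they are finitely many.\<close>
    have "\<forall>\<^sub>F t in nhds 0. \<forall>k\<in>K - tight. V k (ln_y t) < \<tau>"
    proof (intro eventually_ball_finite ballI)
      show "finite (K - tight)" using finK by simp
      fix k assume "k \<in> K - tight"
      then have lt: "V k (ln_y 0) < \<tau>" using y(4)[of k] by (auto simp: tight_def ln_y_def)
      have cont: "isCont (\<lambda>t. V k (ln_y t)) 0"
        unfolding V_def ln_y_def by (intro continuous_intros isCont_sqrt_mgf_line[where u = u, OF y(1) u_alive])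
      from order_tendstoD(2)[OF cont[unfolded isCont_def] lt] lt
      show "\<forall>\<^sub>F t in nhds 0. V k (ln_y t) < \<tau>"
        by (simp add: eventually_nhds_conv_at)
    qed
    then obtain r1 where r1: "0 < r1" "\<And>t k. \<bar>t\<bar> < r1 \<Longrightarrow> k \<in> K - tight \<Longrightarrow> V k (ln_y t) < \<tau>"
      by (auto simp: eventually_nhds_metric dist_real_def)
    have feasible: "ln_y t \<in> F" if t: "\<bar>t\<bar> < min r0 r1" for t
    proof -
      have in_cube: "ln_y t \<in> cube n" using r0(2) t by simp
      have "V k (ln_y t) \<le> \<tau>" if "k \<in> K" for k
      proof (cases "k \<in> tight")
        case True
        have "sqrt_mgf n (\<beta> k) (ln_y t) \<le> sqrt_mgf n (\<beta> k) y"
          using sqrt_mgf_nonincreasing_along_tangent[where u = u, OF y(1) u_alive kill_tight[OF True]] in_cube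
          by (simp add: ln_y_def)
        then have "V k (ln_y t) \<le> V k y" unfolding V_def by (intro mult_left_mono) (simp_all add: v_def)
        then show ?thesis using True by (simp add: tight_def)
      next
        case False
        then show ?thesis using r1(2)[of t k] t that by simp
      qed
      moreover have "orth A (ln_y t)"
      proof -
        have "(\<Sum>j<n. a r j * ln_y t j) = (\<Sum>j<n. a r j * y j) + t * (\<Sum>j<n. a r j * u j)" for r
          by (simp add: ln_y_def distrib_left sum.distrib sum_distrib_left mult_ac)
        then show ?thesis using y(3) kill_big by (simp add: orth_def)
      qed
      moreover have "ln_y t j = x j" if "j \<notin> A" for j
        using y(2) u(2) that by (simp add: ln_y_def)
      ultimately show ?thesis using in_cube by (simp add: F_def)
    qed
    have "\<exists>t. \<bar>t\<bar> < min r0 r1 \<and>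
        (\<Sum>q\<in>Q. c q * sqrt_mgf n (\<mu> q) (ln_y t)) - \<eta> * (\<Sum>j<n. (ln_y t j)\<^sup>2)
        < (\<Sum>q\<in>Q. c q * sqrt_mgf n (\<mu> q) y) - \<eta> * (\<Sum>j<n. (y j)\<^sup>2)"
      unfolding ln_y_def
      by (rule potential_decreases_along_line[where u = u, OF y(1) u_alive finQ \<eta>])
        (use r0(1) r1(1) u(1) u_dom in \<open>auto simp: sumA sumA2 sumA_sq slope_def\<close>)
    then obtain t where t: "\<bar>t\<bar> < min r0 r1" "\<Psi> A (ln_y t) < \<Psi> A y"
      by (auto simp: \<Psi>_eq)
    then show False using y_min[OF feasible[OF t(1)]] by simp
  qed
  have "\<bar>\<Sum>j<n. b i j * (y j - x0 j)\<bar> \<le> 2 * ln \<tau>" if i: "i \<in> J" for i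
  proof -
    have "s * (\<Sum>j<n. b i j * (y j - x0 j)) \<le> 2 * ln \<tau>" if "s \<in> {1, -1}" for s
    proof -
      have "exp (s * (\<Sum>j<n. b i j * (y j - x0 j)) / 2)
          = v (i, s) * exp ((\<Sum>j<n. \<beta> (i, s) j * y j) / 2)"
        by (simp add: v_def \<beta>_def exp_add[symmetric] right_diff_distrib sum_subtractf
            sum_distrib_left mult.assoc diff_divide_distrib)
      also have "\<dots> \<le> V (i, s) y"
        unfolding V_def by (intro mult_left_mono sqrt_mgf_ge y) (simp add: v_def)
      also have "\<dots> \<le> \<tau>" using i that by (intro y) (simp add: K_def)
      finally have "s * (\<Sum>j<n. b i j * (y j - x0 j)) / 2 \<le> ln \<tau>"
        using ln_ge_iff[OF \<tau>_pos] by blast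
      then show ?thesis by simp
    qed
    from this[of 1] this[of "-1"] show ?thesis by simp
  qed
  moreover have "potential A y \<le> g + 2"
  proof -
    have "0 \<le> \<alpha> * (\<Sum>k\<in>K. V k y)"
      using \<alpha> V_pos by (intro mult_nonneg_nonneg sum_nonneg) (auto simp: less_imp_le)
    then show ?thesis using total by simp
  qed
  ultimately show ?thesis
    using y few good_y by (intro bexI[of _ y]) (auto simp: alive_y good_def)
qed

text \<open>Induction over the phases. In phase \<open>p\<close> the squared row mass falls like
  \<open>16 ^ p\<close> while the logarithm that enters the bound grows only linearly in
  \<open>p\<close>, so the increments are dominated by a geometric series of ratio 1/2.\<close>

lemma partial_colouring:
  fixes J :: "'i set" and G :: "'i \<Rightarrow> nat \<Rightarrow> real" and p :: nat
  assumes J: "finite J" "n \<le> card J"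
    and G: "\<And>i. i \<in> J \<Longrightarrow> (\<Sum>j<n. (G i j)^4) \<le> 16 * real n"
  shows "\<exists>x\<in>cube n. card (alive n x) \<le> n / 256 ^ p \<and> orth (alive n x) x
    \<and> potential (alive n x) x \<le> 1 + 2 * p
    \<and> (\<forall>i\<in>J. \<bar>\<Sum>j<n. G i j * x j\<bar> \<le> 90 * sqrt (n * ln (2 * card J / n)) * (\<Sum>q<p. (1/2) ^ q))"
proof (induction p)
  case 0
  have "alive n (\<lambda>_. 0) = {..<n}" by (auto simp: alive_def)
  then show ?case using potential_zero
    by (intro bexI[of _ "\<lambda>_. 0"]) (auto simp: orth_def cube_def)
next
  case (Suc p)
  then obtain x0 where x0: "x0 \<in> cube n" "card (alive n x0) \<le> n / 256 ^ p" "orth (alive n x0) x0"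
      "potential (alive n x0) x0 \<le> 1 + 2 * p"
      "\<And>i. i \<in> J \<Longrightarrow> \<bar>\<Sum>j<n. G i j * x0 j\<bar> \<le> 90 * sqrt (n * ln (2 * card J / n)) * (\<Sum>q<p. (1/2) ^ q)"
    by blast
  define m where "m = card J"
  define N where "N = n / 256 ^ p"
  \<comment> \<open>\<open>\<rho>\<close> is the square root of \<open>N * (16 * n)\<close>, the
    Cauchy-Schwarz bound on the squared mass of a row on the alive coordinates. The factor
    \<open>s\<close> rescales that mass to the \<open>4 * l\<close> that a phase expects.\<close>
  define \<rho> where "\<rho> = 4 * real n / 16 ^ p"
  define L where "L = ln (2 * m / n)"
  define l where "l = ln (2 * m / N)"
  define s where "s = sqrt (4 * l / \<rho>)"
  have m: "n \<le> m" "0 < m" using J n_pos by (auto simp: m_def)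
  have N: "0 < N" using n_pos by (simp add: N_def)
  have \<rho>: "0 < \<rho>" using n_pos by (simp add: \<rho>_def)
  have exp_l: "exp l = 2 * m / N" using m N by (simp add: l_def)
  have "2 \<le> 2 * real m / n" using m n_pos by (simp add: field_simps)
  then have L_ge: "ln 2 \<le> L" unfolding L_def by (subst ln_le_cancel_iff) auto
  have L_pos: "0 < L" using L_ge ln_gt_zero[of "2::real"] by linarith
  \<comment> \<open>The potential grows by 2 per phase; \<open>exp l\<close>, which is at least
    \<open>2 * 256 ^ p\<close>, dominates this growth.\<close>
  have pow: "1 + 255 * real p \<le> 256 ^ p"
    using Bernoulli_inequality[of "255::real" p] by (simp add: mult.commute)
  have "2 * 256 ^ p \<le> 2 * m / N" using m n_pos by (simp add: N_def field_simps)
  then have X: "2 * (1 + real p) \<le> exp l" using pow by (simp add: exp_l)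
  have l_pos: "0 < l"
  proof -
    have "1 < 2 * (1 + real p)" by simp
    also note X
    finally have "1 < exp l" .
    then show ?thesis by simp
  qed
  have s: "0 < s" "s\<^sup>2 = 4 * l / \<rho>" using l_pos \<rho> by (simp_all add: s_def)
  have b: "(\<Sum>j\<in>alive n x0. (s * G i j)\<^sup>2) \<le> 4 * l" if "i \<in> J" for i
  proof -
    have "(\<Sum>j\<in>alive n x0. (G i j)\<^sup>2) \<le> sqrt (card (alive n x0) * (16 * real n))"
      using G[OF that] by (intro sum_squares_le_of_sum_fourth_powers) (auto simp: alive_def)
    also have "\<dots> \<le> sqrt (N * (16 * real n))"
      using x0(2) by (intro real_sqrt_le_mono mult_right_mono) (auto simp: N_def)
    also have "N * (16 * real n) = \<rho>\<^sup>2"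
      by (simp add: N_def \<rho>_def power2_eq_square power_mult_distrib[symmetric])
    finally have "(\<Sum>j\<in>alive n x0. (G i j)\<^sup>2) \<le> \<rho>" using \<rho> by simp
    then have "s\<^sup>2 * (\<Sum>j\<in>alive n x0. (G i j)\<^sup>2) \<le> s\<^sup>2 * \<rho>" by (intro mult_left_mono) auto
    then show ?thesis using s \<rho> by (simp add: power_mult_distrib sum_distrib_left)
  qed
  have \<tau>1: "exp l \<le> exp (15 * l)" using l_pos by simp
  have \<tau>2: "(1 + 2 * p + 2) * (2 * card J * exp l) \<le> exp (15 * l) * N / 1024"
  proof -
    \<comment> \<open>Since \<open>2 * card J = Y * N\<close>, two powers of \<open>Y\<close> come
      from the row count and \<open>exp l\<close>. Two more absorb \<open>3 + 2 * p\<close> and ten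
      absorb \<open>1024 = 2 ^ 10\<close>, so the exponent 15 suffices.\<close>
    define Y where "Y = exp l"
    have Y: "2 * (1 + real p) \<le> Y" using X by (simp add: Y_def)
    have Y2: "2 \<le> Y" using Y by simp
    have "(3 + 2 * real p) * 1024 \<le> Y\<^sup>2 * Y ^ 10"
    proof (intro mult_mono)
      have "3 + 2 * real p \<le> 2 * Y" using Y by simp
      also have "\<dots> \<le> Y\<^sup>2" using Y2 by (simp add: power2_eq_square)
      finally show "3 + 2 * real p \<le> Y\<^sup>2" .
      have "(2::real) ^ 10 \<le> Y ^ 10" using Y2 by (intro power_mono) auto
      then show "1024 \<le> Y ^ 10" by simp
    qed auto
    also have "\<dots> = Y ^ 12" by (simp add: power_add[symmetric])
    finally have "(3 + 2 * real p) * 1024 * Y\<^sup>2 \<le> Y ^ 12 * Y\<^sup>2" by (intro mult_right_mono) auto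
    also have "\<dots> = Y ^ 14" by (simp add: power_add[symmetric])
    also have "\<dots> \<le> Y ^ 15" using Y2 by (intro power_increasing) auto
    also have "\<dots> = exp (15 * l)" using exp_of_nat_mult[of 15 l] by (simp add: Y_def)
    finally have "(3 + 2 * real p) * 1024 * Y\<^sup>2 * N \<le> exp (15 * l) * N"
      using N by (intro mult_right_mono) auto
    moreover have "2 * real (card J) = Y * N" using N by (simp add: Y_def exp_l m_def)
    ultimately show ?thesis by (simp add: Y_def[symmetric] power2_eq_square field_simps)
  qed
  have "J \<noteq> {}" using m by (auto simp: m_def)
  obtain x where x: "x \<in> cube n" "alive n x \<subseteq> alive n x0" "card (alive n x) \<le> N / 256"
      "orth (alive n x) x" "potential (alive n x) x \<le> 1 + 2 * p + 2"
      "\<And>i. i \<in> J \<Longrightarrow> \<bar>\<Sum>j<n. s * G i j * (x j - x0 j)\<bar> \<le> 2 * ln (exp (15 * l))"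
    using discrepancy_phase[OF J(1) \<open>J \<noteq> {}\<close> x0(1,3,4), of "\<lambda>i j. s * G i j" l "exp (15 * l)" N]
      b \<tau>1 \<tau>2 by auto
  have step: "\<bar>\<Sum>j<n. G i j * (x j - x0 j)\<bar> \<le> 90 * sqrt (n * L) * (1/2) ^ p" if "i \<in> J" for i
  proof -
    have "s * \<bar>\<Sum>j<n. G i j * (x j - x0 j)\<bar> = \<bar>\<Sum>j<n. s * G i j * (x j - x0 j)\<bar>"
      using s(1) by (simp add: mult.assoc sum_distrib_left[symmetric] abs_mult)
    also have "\<dots> \<le> 30 * l" using x(6)[OF that] by simp
    also have "\<dots> = s * (15 * sqrt (l * \<rho>))"
      using l_pos \<rho> by (simp add: s_def real_sqrt_mult real_sqrt_divide field_simps)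
    finally have "\<bar>\<Sum>j<n. G i j * (x j - x0 j)\<bar> \<le> 15 * sqrt (l * \<rho>)"
      using s(1) by simp
    \<comment> \<open>\<open>l\<close> exceeds \<open>L\<close> by \<open>p * ln 256\<close>, at
      most \<open>8 * p * L\<close>. The resulting factor is at most \<open>9 * 4 ^ p\<close>, and
      against \<open>16 ^ p\<close> in \<open>\<rho>\<close> this leaves the square of
      \<open>(1/2) ^ p\<close>.\<close>
    also have "15 * sqrt (l * \<rho>) \<le> 15 * sqrt ((6 * (1/2) ^ p)\<^sup>2 * (n * L))"
    proof (intro mult_left_mono real_sqrt_le_mono)
      have "l = ln (2 * m / n * 256 ^ p)" by (simp add: l_def N_def)
      also have "\<dots> = L + p * ln 256"
        using ln_mult[of "2 * real m / n" "256 ^ p"] m n_pos by (simp add: L_def ln_realpow)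
      also have "ln (256::real) = 8 * ln 2" using ln_realpow[of "2::real" 8] by simp
      also have "L + p * (8 * ln 2) \<le> L + p * (8 * L)"
        using L_ge by (intro add_left_mono mult_left_mono) auto
      also have "\<dots> = (1 + 8 * real p) * L" by (simp add: algebra_simps)
      also have "\<dots> \<le> (9 * 4 ^ p) * L"
      proof (intro mult_right_mono)
        show "1 + 8 * real p \<le> 9 * 4 ^ p"
          using Bernoulli_inequality[of "3::real" p] by (simp add: mult.commute)
      qed (use L_pos in auto)
      finally have "l * \<rho> \<le> 9 * 4 ^ p * L * \<rho>" using \<rho> by (intro mult_right_mono) auto
      also have "\<dots> = (6 * (1/2) ^ p)\<^sup>2 * (n * L)"
      proof -
        have "(16::real) ^ p = 4 ^ p * 4 ^ p" by (simp add: power_mult_distrib[symmetric])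
        moreover have "((1/2::real) ^ p)\<^sup>2 = 1 / 4 ^ p"
          by (simp add: power_divide power_mult[symmetric] mult.commute[of p]) (simp add: power_mult)
        ultimately show ?thesis by (simp add: \<rho>_def power_mult_distrib)
      qed
      finally show "l * \<rho> \<le> (6 * (1/2) ^ p)\<^sup>2 * (n * L)" .
    qed simp
    also have "\<dots> = 90 * sqrt (n * L) * (1/2) ^ p"
      by (simp add: real_sqrt_mult del: power_mult_distrib)
    finally show ?thesis .
  qed
  have "\<bar>\<Sum>j<n. G i j * x j\<bar> \<le> 90 * sqrt (n * L) * (\<Sum>q<Suc p. (1/2) ^ q)" if "i \<in> J" for i
  proof -
    have "(\<Sum>j<n. G i j * x j) = (\<Sum>j<n. G i j * x0 j) + (\<Sum>j<n. G i j * (x j - x0 j))"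
      by (simp add: sum.distrib[symmetric] algebra_simps)
    then have "\<bar>\<Sum>j<n. G i j * x j\<bar> \<le> \<bar>\<Sum>j<n. G i j * x0 j\<bar> + \<bar>\<Sum>j<n. G i j * (x j - x0 j)\<bar>"
      by linarith
    also have "\<dots> \<le> 90 * sqrt (n * L) * (\<Sum>q<p. (1/2) ^ q) + 90 * sqrt (n * L) * (1/2) ^ p"
      using x0(5)[OF that] step[OF that] by (intro add_mono) (simp_all add: L_def m_def)
    finally show ?thesis by (simp add: distrib_left)
  qed
  then show ?case
    using x by (intro bexI[of _ x]) (auto simp: N_def L_def m_def)
qed

text \<open>After \<open>n\<close> phases fewer than one coordinate is alive, so all are signs. Rows
  of weight below \<open>1 / n\<close> are bounded by Cauchy-Schwarz, the others by the potential;
  with \<open>\<kappa>\<^sup>2 = ln n\<close> both \<open>row_cap\<close> and the potential are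
  polynomial in \<open>n\<close>.\<close>

lemma full_colouring:
  fixes J :: "'i set" and G :: "'i \<Rightarrow> nat \<Rightarrow> real"
  assumes J: "finite J" "n \<le> card J"
    and G: "\<And>i. i \<in> J \<Longrightarrow> (\<Sum>j<n. (G i j)^4) \<le> 16 * real n"
    and n: "2 \<le> n" and \<kappa>: "\<kappa> = sqrt (ln n)"
  shows "\<exists>x. (\<forall>j<n. x j \<in> {-1, 1}) \<and> (\<forall>r\<in>I. \<bar>\<Sum>j<n. a r j * x j\<bar> \<le> 14 * sqrt (ln n))
    \<and> (\<forall>i\<in>J. \<bar>\<Sum>j<n. G i j * x j\<bar> \<le> 180 * sqrt (n * ln (2 * card J / n)))"
proof -
  obtain x where x: "x \<in> cube n" "card (alive n x) \<le> n / 256 ^ n" "potential (alive n x) x \<le> 1 + 2 * n"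
      "\<And>i. i \<in> J \<Longrightarrow> \<bar>\<Sum>j<n. G i j * x j\<bar> \<le> 90 * sqrt (n * ln (2 * card J / n)) * (\<Sum>q<n. (1/2) ^ q)"
    using partial_colouring[where G = G and p = n, OF J G] by auto
  have "real n < 2 ^ n" by (rule of_nat_less_two_power)
  also have "(2::real) ^ n \<le> 256 ^ n" by (intro power_mono) auto
  finally have "n / 256 ^ n < (1::real)" by simp
  then have "real (card (alive n x)) < 1" using x(2) by linarith
  then have dead: "alive n x = {}" using finite_alive[of n x] by simp
  have signs: "x j \<in> {-1, 1}" if "j < n" for j
    using dead cubeD[OF x(1) that] that by (force simp: alive_def)
  have ln2: "1 / 4 \<le> ln (real n)"
  proof -
    have "1 / 4 \<le> ln (2::real)" using ln_2_less_1 ln_ge_iff[of 2 "1/4"] exp_bound_half[of "1/4::real"]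
      by (auto simp: norm_divide)
    also have "\<dots> \<le> ln n" using n by simp
    finally show ?thesis .
  qed
  have \<kappa>_pos: "0 < \<kappa>" and \<kappa>2: "\<kappa>\<^sup>2 = ln n" using ln2 by (simp_all add: \<kappa>)
  have "\<bar>\<Sum>j<n. a r j * x j\<bar> \<le> 14 * sqrt (ln n)" if r: "r \<in> I" for r
  proof (cases "1 / n \<le> row_weight r")
    case False
    have "\<bar>\<Sum>j<n. a r j * x j\<bar>\<^sup>2 \<le> (\<Sum>j<n. (a r j)\<^sup>2) * (\<Sum>j<n. (x j)\<^sup>2)"
      using Cauchy_Schwarz_ineq_sum[of "a r" x "{..<n}"] by simp
    also have "(\<Sum>j<n. (x j)\<^sup>2) = (\<Sum>j<n. 1)" using signs by (intro sum.cong) (auto simp: power2_eq_1_iff)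
    also have "(\<Sum>j<n. (a r j)\<^sup>2) * (\<Sum>j<n. 1) \<le> 1"
      using False n_pos by (simp add: row_weight_def field_simps)
    finally have "\<bar>\<Sum>j<n. a r j * x j\<bar> \<le> 1" using abs_square_le_1 by fastforce
    moreover have "sqrt (1 / 4) \<le> sqrt (ln n)" using ln2 by (rule real_sqrt_le_mono)
    ultimately show ?thesis by (simp add: real_sqrt_divide)
  next
    case True
    have "big {} = {}" by (simp add: big_def)
    then have "(\<Sum>r\<in>I. row_weight r * row_potential r x) \<le> (1 + 2 * real n) * (2 * row_cap * n)"
      using x(3) row_cap_pos n_pos by (simp add: dead potential_def pos_divide_le_eq)
    moreover have "row_weight r * row_potential r x \<le> (\<Sum>r\<in>I. row_weight r * row_potential r x)"
      using r finite_rows row_weight_nonneg row_potential_pos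
      by (intro member_le_sum mult_nonneg_nonneg) (auto simp: less_imp_le)
    moreover have "1 / n * row_potential r x \<le> row_weight r * row_potential r x"
      using True row_potential_pos by (intro mult_right_mono) (auto simp: less_imp_le)
    ultimately have "1 / n * row_potential r x \<le> (1 + 2 * real n) * (2 * row_cap * n)" by linarith
    also have "\<dots> \<le> (3 * n) * (2 * row_cap * n)"
      using n_pos row_cap_pos by (intro mult_right_mono) auto
    finally have row_potential_le: "row_potential r x \<le> 6 * real n ^ 3 * row_cap"
      using n_pos by (simp add: field_simps power3_eq_cube)
    have "s * (\<Sum>j<n. a r j * x j) \<le> 14 * sqrt (ln n)" if s: "s \<in> {1, -1}" for s
    proof -
      have "exp (\<kappa> * (s * (\<Sum>j<n. a r j * x j)) / 2) \<le> sqrt_mgf n (\<lambda>j. s * \<kappa> * a r j) x"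
        using sqrt_mgf_ge[OF x(1), of "\<lambda>j. s * \<kappa> * a r j"] by (simp add: sum_distrib_left mult_ac)
      also have "\<dots> \<le> row_potential r x" using s sqrt_mgf_pos[of n _ x] by (auto simp: row_potential_def less_imp_le)
      also note row_potential_le
      finally have "\<kappa> * (s * (\<Sum>j<n. a r j * x j)) / 2 \<le> ln (6 * real n ^ 3 * row_cap)"
        using n_pos row_cap_pos by (subst ln_ge_iff) auto
      \<comment> \<open>With \<open>6 \<le> n ^ 3\<close> this is at most \<open>7 * ln n\<close>;
        undoing the halving in the exponent gives the constant 14.\<close>
      also have "\<dots> = ln 6 + 3 * ln n + ln n"
        using n_pos row_cap_pos by (simp add: ln_mult ln_realpow row_cap_def \<kappa>2)
      also have "ln 6 \<le> ln (real n ^ 3)"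
      proof -
        have "(2::real) ^ 3 \<le> real n ^ 3" using n by (intro power_mono) auto
        then show ?thesis using n_pos by simp
      qed
      also have "ln (real n ^ 3) = 3 * ln n" using n_pos by (simp add: ln_realpow)
      finally have "\<kappa> * (s * (\<Sum>j<n. a r j * x j)) \<le> \<kappa> * (14 * \<kappa>)"
        using \<kappa>2 by (simp add: power2_eq_square)
      then show ?thesis using \<kappa>_pos by (simp add: \<kappa>)
    qed
    from this[of 1] this[of "-1"] show ?thesis by simp
  qed
  moreover have "\<bar>\<Sum>j<n. G i j * x j\<bar> \<le> 180 * sqrt (n * ln (2 * card J / n))" if "i \<in> J" for i
  proof -
    have "1 \<le> 2 * real (card J) / n" using J(2) n_pos by (simp add: field_simps)
    then have "0 \<le> sqrt (n * ln (2 * card J / n))" by simp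
    moreover have "(\<Sum>q<n. (1/2::real) ^ q) \<le> 2" by (simp add: geometric_sum)
    ultimately have "90 * sqrt (n * ln (2 * card J / n)) * (\<Sum>q<n. (1/2) ^ q)
        \<le> 90 * sqrt (n * ln (2 * card J / n)) * 2" by (intro mult_left_mono) auto
    then show ?thesis using x(4)[OF that] by linarith
  qed
  ultimately show ?thesis using signs by blast
qed

end

section \<open>Gaussian rows\<close>

lemma sets_centred_normal [simp, measurable_cong]: "sets (centred_normal \<sigma>) = sets borel"
  by (simp add: centred_normal_def)

lemma space_centred_normal [simp]: "space (centred_normal \<sigma>) = UNIV"
  by (simp add: centred_normal_def)

lemma nn_integral_normal_density:
  assumes "0 < \<sigma>"
  shows "(\<integral>\<^sup>+ x. ennreal (normal_density \<mu> \<sigma> x) \<partial>lborel) = 1"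
proof -
  interpret prob_space "density lborel (\<lambda>x. ennreal (normal_density \<mu> \<sigma> x))"
    using assms by (rule prob_space_normal_density)
  show ?thesis using emeasure_space_1 by (simp add: emeasure_density)
qed

text \<open>Completing the square turns the exponentially tilted density into a multiple of a
  shifted normal density.\<close>

lemma centred_normal_mgf:
  assumes "0 < \<sigma>"
  shows "(\<integral>\<^sup>+ y. ennreal (exp (\<theta> * y)) \<partial>centred_normal \<sigma>) = ennreal (exp (\<theta>\<^sup>2 * \<sigma>\<^sup>2 / 2))"
proof -
  have shift: "normal_density 0 \<sigma> y * exp (\<theta> * y)
      = exp (\<theta>\<^sup>2 * \<sigma>\<^sup>2 / 2) * normal_density (\<theta> * \<sigma>\<^sup>2) \<sigma> y" for y
  proof -
    have "- (y - 0)\<^sup>2 / (2 * \<sigma>\<^sup>2) + \<theta> * y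
        = \<theta>\<^sup>2 * \<sigma>\<^sup>2 / 2 + - (y - \<theta> * \<sigma>\<^sup>2)\<^sup>2 / (2 * \<sigma>\<^sup>2)"
      using assms by (simp add: field_simps power2_eq_square)
    then show ?thesis
      unfolding normal_density_def by (simp only: mult.assoc exp_add[symmetric] mult.left_commute[of _ "1 / _"])
  qed
  have "(\<integral>\<^sup>+ y. ennreal (exp (\<theta> * y)) \<partial>centred_normal \<sigma>)
      = (\<integral>\<^sup>+ y. ennreal (normal_density 0 \<sigma> y) * ennreal (exp (\<theta> * y)) \<partial>lborel)"
    using assms by (simp add: centred_normal_def nn_integral_density)
  also have "\<dots> = (\<integral>\<^sup>+ y. ennreal (exp (\<theta>\<^sup>2 * \<sigma>\<^sup>2 / 2)) * ennreal (normal_density (\<theta> * \<sigma>\<^sup>2) \<sigma> y) \<partial>lborel)"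
    by (simp add: ennreal_mult[symmetric] shift)
  also have "\<dots> = ennreal (exp (\<theta>\<^sup>2 * \<sigma>\<^sup>2 / 2))"
    using assms by (simp add: nn_integral_cmult nn_integral_normal_density)
  finally show ?thesis .
qed

lemma centred_normal_fourth_moment:
  assumes "0 < \<sigma>"
  shows "(\<integral>\<^sup>+ y. ennreal ((y / \<sigma>) ^ 4) \<partial>centred_normal \<sigma>) = 3"
proof -
  have int: "has_bochner_integral lborel (\<lambda>y. normal_density 0 \<sigma> y * y ^ 4 / \<sigma> ^ 4) (3 * \<sigma> ^ 4 / \<sigma> ^ 4)"
  proof (rule has_bochner_integral_divide_zero)
    have "fact (2 * 2) / ((2 / \<sigma>\<^sup>2)\<^sup>2 * fact 2) = 3 * \<sigma> ^ 4"
      using assms by (simp add: fact_numeral power_divide field_simps flip: power_mult)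
    then show "has_bochner_integral lborel (\<lambda>y. normal_density 0 \<sigma> y * y ^ 4) (3 * \<sigma> ^ 4)"
      using normal_moment_even[OF assms, of 0 2] by simp
  qed
  have "(\<integral>\<^sup>+ y. ennreal ((y / \<sigma>) ^ 4) \<partial>centred_normal \<sigma>)
      = (\<integral>\<^sup>+ y. ennreal (normal_density 0 \<sigma> y) * ennreal ((y / \<sigma>) ^ 4) \<partial>lborel)"
    using assms by (simp add: centred_normal_def nn_integral_density)
  also have "\<dots> = (\<integral>\<^sup>+ y. ennreal (normal_density 0 \<sigma> y * y ^ 4 / \<sigma> ^ 4) \<partial>lborel)"
    by (simp add: ennreal_mult[symmetric] power_divide)
  also have "\<dots> = ennreal (3 * \<sigma> ^ 4 / \<sigma> ^ 4)"
    using int assms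
    by (subst nn_integral_eq_integral)
       (auto simp: has_bochner_integral_iff zero_le_power_eq normal_density_nonneg)
  finally show ?thesis using assms by simp
qed

section \<open>Tail bounds for one row of the array\<close>

lemma measurable_gaussian_array_entry [measurable]:
  assumes "i < m" "j < n"
  shows "(\<lambda>\<omega>. \<omega> (i, j)) \<in> borel_measurable (gaussian_array m n \<sigma>)"
proof -
  have "(\<lambda>\<omega>. \<omega> (i, j)) \<in> measurable (gaussian_array m n \<sigma>) (centred_normal \<sigma>)"
    unfolding gaussian_array_def using assms by (intro measurable_component_singleton) auto
  then show ?thesis by (simp cong: measurable_cong_sets)
qed

text \<open>Exponential Markov inequality; by independence the expectation factorises, and entries
  outside row \<open>i\<close> contribute 1. The functions \<open>g\<close> are general to cover
  both linear forms and truncated fourth powers.\<close>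

lemma gaussian_array_row_chernoff:
  fixes g :: "nat \<Rightarrow> real \<Rightarrow> real" and B :: "nat \<Rightarrow> real"
  assumes "0 \<le> \<sigma>" "i < m"
    and g [measurable]: "\<And>j. j < n \<Longrightarrow> g j \<in> borel_measurable borel"
    and B: "\<And>j. j < n \<Longrightarrow> (\<integral>\<^sup>+ y. ennreal (exp (g j y)) \<partial>centred_normal \<sigma>) \<le> ennreal (B j)"
      "\<And>j. j < n \<Longrightarrow> 0 \<le> B j"
  shows "\<P>(\<omega> in gaussian_array m n \<sigma>. t \<le> (\<Sum>j<n. g j (\<omega> (i, j)))) \<le> exp (- t) * (\<Prod>j<n. B j)"
proof -
  let ?K = "{..<m} \<times> {..<n}" and ?M = "gaussian_array m n \<sigma>"
  interpret N: prob_space "centred_normal \<sigma>" by (rule prob_space_centred_normal[OF assms(1)])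
  interpret product_sigma_finite "\<lambda>_ :: nat \<times> nat. centred_normal \<sigma>" by standard
  interpret M: prob_space ?M by (rule prob_space_gaussian_array[OF assms(1)])
  define f where "f = (\<lambda>p y. if fst p = i then ennreal (exp (g (snd p) y)) else 1)"
  have f_meas: "f p \<in> borel_measurable (centred_normal \<sigma>)" if "p \<in> ?K" for p
  proof -
    have [measurable]: "g (snd p) \<in> borel_measurable (centred_normal \<sigma>)"
      using g[of "snd p"] that by (auto cong: measurable_cong_sets)
    show ?thesis unfolding f_def by measurable
  qed
  have row: "(\<Prod>p\<in>?K. (if fst p = i then h (snd p) else 1)) = (\<Prod>j<n. h j)" for h :: "nat \<Rightarrow> ennreal"
  proof -
    have "(\<Prod>p\<in>?K. (if fst p = i then h (snd p) else 1)) = (\<Prod>i'<m. \<Prod>j<n. if i' = i then h j else 1)"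
      by (simp add: prod.cartesian_product split_def)
    also have "\<dots> = (\<Prod>i'<m. if i' = i then (\<Prod>j<n. h j) else 1)"
      by (intro prod.cong) auto
    also have "\<dots> = (\<Prod>j<n. h j)" using assms(2) by simp
    finally show ?thesis .
  qed
  have prod_f: "(\<Prod>p\<in>?K. f p (\<omega> p)) = ennreal (exp (\<Sum>j<n. g j (\<omega> (i, j))))" for \<omega>
  proof -
    have "(\<Prod>p\<in>?K. f p (\<omega> p)) = (\<Prod>p\<in>?K. if fst p = i then ennreal (exp (g (snd p) (\<omega> (i, snd p)))) else 1)"
      by (intro prod.cong) (auto simp: f_def)
    also have "\<dots> = (\<Prod>j<n. ennreal (exp (g j (\<omega> (i, j)))))" by (rule row)
    finally show ?thesis by (simp add: prod_ennreal exp_sum)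
  qed
  have "emeasure ?M {\<omega>\<in>space ?M. t \<le> (\<Sum>j<n. g j (\<omega> (i, j)))}
      = emeasure ?M ({\<omega>\<in>space ?M. 1 \<le> ennreal (exp (- t)) * (\<Prod>p\<in>?K. f p (\<omega> p))})"
    by (intro arg_cong[where f = "emeasure ?M"] Collect_cong)
       (simp add: prod_f ennreal_mult[symmetric] exp_add[symmetric] flip: ennreal_1)
  also have "\<dots> \<le> ennreal (exp (- t)) * (\<integral>\<^sup>+ \<omega>. (\<Prod>p\<in>?K. f p (\<omega> p)) \<partial>?M)"
  proof -
    have [measurable]: "(\<lambda>\<omega>. (\<Prod>p\<in>?K. f p (\<omega> p))) \<in> borel_measurable ?M"
      unfolding gaussian_array_def
    proof (intro borel_measurable_prod_ennreal)
      fix p assume p: "p \<in> ?K"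
      show "(\<lambda>\<omega>. f p (\<omega> p)) \<in> borel_measurable (PiM ?K (\<lambda>_. centred_normal \<sigma>))"
        by (rule measurable_compose[OF measurable_component_singleton[OF p] f_meas[OF p]])
    qed
    have "(\<integral>\<^sup>+ \<omega>. (\<Prod>p\<in>?K. f p (\<omega> p)) * indicator (space ?M) \<omega> \<partial>?M)
        = (\<integral>\<^sup>+ \<omega>. (\<Prod>p\<in>?K. f p (\<omega> p)) \<partial>?M)"
      by (intro nn_integral_cong) simp
    then show ?thesis
      using nn_integral_Markov_inequality[of "\<lambda>\<omega>. \<Prod>p\<in>?K. f p (\<omega> p)" "space ?M" ?M "ennreal (exp (- t))"]
      by simp
  qed
  also have "(\<integral>\<^sup>+ \<omega>. (\<Prod>p\<in>?K. f p (\<omega> p)) \<partial>?M) = (\<Prod>p\<in>?K. \<integral>\<^sup>+ y. f p y \<partial>centred_normal \<sigma>)"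
    unfolding gaussian_array_def by (rule product_nn_integral_prod) (auto intro: f_meas)
  also have "\<dots> = (\<Prod>p\<in>?K. if fst p = i then (\<integral>\<^sup>+ y. ennreal (exp (g (snd p) y)) \<partial>centred_normal \<sigma>) else 1)"
    using N.emeasure_space_1 by (intro prod.cong) (auto simp: f_def)
  also have "\<dots> = (\<Prod>j<n. \<integral>\<^sup>+ y. ennreal (exp (g j y)) \<partial>centred_normal \<sigma>)" by (rule row)
  also have "ennreal (exp (- t)) * \<dots> \<le> ennreal (exp (- t)) * (\<Prod>j<n. ennreal (B j))"
    using B by (intro mult_left_mono prod_mono_ennreal) auto
  also have "\<dots> = ennreal (exp (- t) * (\<Prod>j<n. B j))"
    using B(2) by (subst prod_ennreal) (auto simp: ennreal_mult')
  finally have le: "ennreal (\<P>(\<omega> in ?M. t \<le> (\<Sum>j<n. g j (\<omega> (i, j))))) \<le> ennreal (exp (- t) * (\<Prod>j<n. B j))"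
    by (simp add: M.emeasure_eq_measure)
  have "0 \<le> exp (- t) * (\<Prod>j<n. B j)"
    using B(2) by (intro mult_nonneg_nonneg prod_nonneg) auto
  then show ?thesis using le by simp
qed

lemma gaussian_array_row_tail:
  assumes "0 < \<sigma>" "i < m" "0 < v" and v: "(\<Sum>j<n. (x j)\<^sup>2) = v" and "0 \<le> t"
  shows "\<P>(\<omega> in gaussian_array m n \<sigma>. t \<le> \<bar>\<Sum>j<n. x j * \<omega> (i, j)\<bar>) \<le> 2 * exp (- t\<^sup>2 / (2 * \<sigma>\<^sup>2 * v))"
proof -
  let ?M = "gaussian_array m n \<sigma>"
  interpret prob_space ?M using assms(1) by (intro prob_space_gaussian_array) simp
  have one: "\<P>(\<omega> in ?M. t \<le> (\<Sum>j<n. s * x j * \<omega> (i, j))) \<le> exp (- t\<^sup>2 / (2 * \<sigma>\<^sup>2 * v))"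
    if s: "s\<^sup>2 = 1" for s
  proof (cases "t = 0")
    case True
    then show ?thesis by simp
  next
    case False
    \<comment> \<open>The minimiser of the Chernoff exponent
      \<open>- \<theta> * t + \<theta>\<^sup>2 * v * \<sigma>\<^sup>2 / 2\<close>.\<close>
    define \<theta> where "\<theta> = t / (\<sigma>\<^sup>2 * v)"
    have \<theta>: "0 < \<theta>" using assms False by (simp add: \<theta>_def)
    have "\<P>(\<omega> in ?M. t \<le> (\<Sum>j<n. s * x j * \<omega> (i, j)))
        = \<P>(\<omega> in ?M. \<theta> * t \<le> (\<Sum>j<n. (\<theta> * s * x j) * \<omega> (i, j)))"
      using \<theta> by (simp add: mult.assoc sum_distrib_left[symmetric])
    also have "\<dots> \<le> exp (- (\<theta> * t)) * (\<Prod>j<n. exp ((\<theta> * s * x j)\<^sup>2 * \<sigma>\<^sup>2 / 2))"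
      using assms(1,2) by (intro gaussian_array_row_chernoff) (auto simp: centred_normal_mgf)
    also have "(\<Prod>j<n. exp ((\<theta> * s * x j)\<^sup>2 * \<sigma>\<^sup>2 / 2)) = exp (\<theta>\<^sup>2 * v * \<sigma>\<^sup>2 / 2)"
      using s v by (simp add: exp_sum[symmetric] power_mult_distrib sum_distrib_left[symmetric]
          sum_distrib_right[symmetric] sum_divide_distrib[symmetric])
    also have "exp (- (\<theta> * t)) * exp (\<theta>\<^sup>2 * v * \<sigma>\<^sup>2 / 2) = exp (- t\<^sup>2 / (2 * \<sigma>\<^sup>2 * v))"
    proof -
      have "- (\<theta> * t) + \<theta>\<^sup>2 * v * \<sigma>\<^sup>2 / 2 = - t\<^sup>2 / (2 * \<sigma>\<^sup>2 * v)"
        using assms by (simp add: \<theta>_def field_simps power2_eq_square)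
      then show ?thesis by (simp add: exp_add[symmetric])
    qed
    finally show ?thesis .
  qed
  have [measurable]: "(\<lambda>\<omega>. \<Sum>j<n. c j * \<omega> (i, j)) \<in> borel_measurable ?M" for c
    using assms(2) by (intro borel_measurable_sum borel_measurable_times) auto
  have "\<P>(\<omega> in ?M. t \<le> \<bar>\<Sum>j<n. x j * \<omega> (i, j)\<bar>)
      \<le> measure ?M ({\<omega>\<in>space ?M. t \<le> (\<Sum>j<n. 1 * x j * \<omega> (i, j))}
        \<union> {\<omega>\<in>space ?M. t \<le> (\<Sum>j<n. - 1 * x j * \<omega> (i, j))})"
    by (intro finite_measure_mono) (auto simp: sum_negf)
  also have "\<dots> \<le> \<P>(\<omega> in ?M. t \<le> (\<Sum>j<n. 1 * x j * \<omega> (i, j)))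
      + \<P>(\<omega> in ?M. t \<le> (\<Sum>j<n. - 1 * x j * \<omega> (i, j)))"
    by (intro measure_Un_le) measurable
  also have "\<dots> \<le> 2 * exp (- t\<^sup>2 / (2 * \<sigma>\<^sup>2 * v))"
    using one[of 1] one[of "-1"] by simp
  finally show ?thesis .
qed

text \<open>
  Fourth powers of Gaussians have no exponential moments, so they are truncated at \<open>L\<close>.
\<close>

lemma gaussian_array_row_fourth_powers:
  assumes "0 < \<sigma>" "i < m" "0 < L"
  shows "\<P>(\<omega> in gaussian_array m n \<sigma>. 16 * real n < (\<Sum>j<n. (\<omega> (i, j) / \<sigma>) ^ 4))
    \<le> n * (2 * exp (- L\<^sup>2 / 2)) + exp (- 10 * n / L ^ 4)"
proof -
  let ?M = "gaussian_array m n \<sigma>"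
  interpret prob_space ?M using assms(1) by (intro prob_space_gaussian_array) simp
  define g where "g = (\<lambda>y. min ((y / \<sigma>) ^ 4) (L ^ 4) / L ^ 4)"
  have g_meas [measurable]: "g \<in> borel_measurable borel" unfolding g_def by measurable
  have entry [measurable]: "(\<lambda>\<omega>. \<omega> (i, j)) \<in> borel_measurable ?M" if "j < n" for j
    using assms(2) that by simp
  \<comment> \<open>Either some entry reaches the truncation level (\<open>U\<close>), or the
    truncation is inactive throughout and the truncated sum is itself large
    (\<open>S\<close>).\<close>
  define S where "S = {\<omega>\<in>space ?M. 16 * n / L ^ 4 \<le> (\<Sum>j<n. g (\<omega> (i, j)))}"
  define U where "U = (\<lambda>j. {\<omega>\<in>space ?M. L * \<sigma> \<le> \<bar>\<omega> (i, j)\<bar>})"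
  have S: "S \<in> sets ?M"
  proof -
    have "(\<lambda>\<omega>. \<Sum>j<n. g (\<omega> (i, j))) \<in> borel_measurable ?M"
      by (intro borel_measurable_sum measurable_compose[OF entry g_meas]) auto
    then show ?thesis unfolding S_def by measurable
  qed
  have U: "U j \<in> sets ?M" if "j < n" for j using entry[OF that] unfolding U_def by measurable
  have prob_U: "prob (U j) \<le> 2 * exp (- L\<^sup>2 / 2)" if "j < n" for j
  proof -
    define x where "x = (\<lambda>k. if k = j then 1 else 0 :: real)"
    have pick: "(\<Sum>k<n. x k * h k) = h j" for h
    proof -
      have "(\<Sum>k<n. x k * h k) = (\<Sum>k<n. if k = j then h k else 0)"
        by (intro sum.cong) (auto simp: x_def)
      then show ?thesis using that by simp
    qed
    have norm_x: "(\<Sum>k<n. (x k)\<^sup>2) = 1" using pick[of x] by (simp add: power2_eq_square) (simp add: x_def)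
    show ?thesis using gaussian_array_row_tail[where v = 1 and n = n and x = x and t = "L * \<sigma>", OF assms(1,2)] assms norm_x by (simp add: pick U_def power_mult_distrib)
  qed
  have prob_S: "prob S \<le> exp (- 10 * n / L ^ 4)"
  proof -
    \<comment> \<open>On the unit interval \<open>exp z \<le> 1 + 2 * z\<close>. With fourth moment
      3 this bounds each factor by \<open>exp (6 / L ^ 4)\<close>, and 16 - 6 gives the 10 in the
      exponent.\<close>
    have "(\<integral>\<^sup>+ y. ennreal (exp (g y)) \<partial>centred_normal \<sigma>)
        \<le> (\<integral>\<^sup>+ y. 1 + ennreal (2 / L ^ 4) * ennreal ((y / \<sigma>) ^ 4) \<partial>centred_normal \<sigma>)"
    proof (intro nn_integral_mono)
      fix y
      have "0 \<le> g y" "g y \<le> 1" using assms by (auto simp: g_def zero_le_power_eq divide_le_eq_1)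
      then have "exp (g y) \<le> 1 + g y + (g y)\<^sup>2" by (rule exp_bound)
      also have "(g y)\<^sup>2 \<le> g y"
        using \<open>0 \<le> g y\<close> \<open>g y \<le> 1\<close> by (simp add: power2_eq_square mult_left_le)
      also have "g y \<le> (y / \<sigma>) ^ 4 / L ^ 4"
        unfolding g_def using assms by (intro divide_right_mono) auto
      finally have "exp (g y) \<le> 1 + 2 / L ^ 4 * (y / \<sigma>) ^ 4" by simp
      then have "ennreal (exp (g y)) \<le> ennreal (1 + 2 / L ^ 4 * (y / \<sigma>) ^ 4)" by (rule ennreal_leI)
      also have "\<dots> = 1 + ennreal (2 / L ^ 4) * ennreal ((y / \<sigma>) ^ 4)"
        using assms by (subst ennreal_plus) (auto simp: ennreal_mult[symmetric] zero_le_power_eq)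
      finally show "ennreal (exp (g y)) \<le> 1 + ennreal (2 / L ^ 4) * ennreal ((y / \<sigma>) ^ 4)" .
    qed
    also have "\<dots> = 1 + ennreal (2 / L ^ 4) * 3"
    proof -
      interpret N: prob_space "centred_normal \<sigma>" using assms(1) by (intro prob_space_centred_normal) simp
      have [measurable]: "(\<lambda>y. ennreal ((y / \<sigma>) ^ 4)) \<in> borel_measurable (centred_normal \<sigma>)"
        by (simp cong: measurable_cong_sets)
      have "(\<integral>\<^sup>+ y. ennreal (2 / L ^ 4) * ennreal ((y / \<sigma>) ^ 4) \<partial>centred_normal \<sigma>) = ennreal (2 / L ^ 4) * 3"
        by (subst nn_integral_cmult) (simp_all only: centred_normal_fourth_moment[OF assms(1)], measurable)
      then show ?thesis using N.emeasure_space_1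
        by (subst nn_integral_add) auto
    qed
    also have "\<dots> = ennreal (1 + 6 / L ^ 4)"
      using assms by (simp add: ennreal_mult[symmetric] flip: ennreal_numeral ennreal_1 ennreal_plus)
    also have "\<dots> \<le> ennreal (exp (6 / L ^ 4))"
      by (intro ennreal_leI) (rule exp_ge_add_one_self)
    finally have "prob S \<le> exp (- (16 * n / L ^ 4)) * (\<Prod>j<n. exp (6 / L ^ 4))"
      unfolding S_def using assms by (intro gaussian_array_row_chernoff) auto
    also have "\<dots> = exp (- (16 * n / L ^ 4) + n * (6 / L ^ 4))"
      by (simp only: prod_constant card_lessThan exp_add exp_of_nat_mult)
    also have "- (16 * n / L ^ 4) + n * (6 / L ^ 4) = - 10 * n / L ^ 4"
      by (simp add: field_simps)
    finally show ?thesis .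
  qed
  have "{\<omega>\<in>space ?M. 16 * real n < (\<Sum>j<n. (\<omega> (i, j) / \<sigma>) ^ 4)} \<subseteq> (\<Union>j<n. U j) \<union> S"
  proof (rule subsetI, rule ccontr)
    fix \<omega> assume \<omega>: "\<omega> \<in> {\<omega>\<in>space ?M. 16 * real n < (\<Sum>j<n. (\<omega> (i, j) / \<sigma>) ^ 4)}"
      and out: "\<omega> \<notin> (\<Union>j<n. U j) \<union> S"
    have "g (\<omega> (i, j)) = (\<omega> (i, j) / \<sigma>) ^ 4 / L ^ 4" if "j < n" for j
    proof -
      have "\<bar>\<omega> (i, j)\<bar> < L * \<sigma>" using out \<omega> that by (force simp: U_def)
      then have "\<bar>\<omega> (i, j) / \<sigma>\<bar> \<le> L" using assms by (simp add: divide_le_eq less_imp_le)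
      then have "\<bar>\<omega> (i, j) / \<sigma>\<bar> ^ 4 \<le> L ^ 4" by (intro power_mono) auto
      then have "(\<omega> (i, j) / \<sigma>) ^ 4 \<le> L ^ 4" by (simp only: power_even_abs[OF even_numeral])
      then show ?thesis by (simp only: g_def min_absorb1)
    qed
    then have "(\<Sum>j<n. g (\<omega> (i, j))) = (\<Sum>j<n. (\<omega> (i, j) / \<sigma>) ^ 4) / L ^ 4"
      by (simp add: sum_divide_distrib)
    moreover have "16 * real n / L ^ 4 < (\<Sum>j<n. (\<omega> (i, j) / \<sigma>) ^ 4) / L ^ 4"
      using \<omega> assms by (intro divide_strict_right_mono) auto
    ultimately show False using out \<omega> by (simp add: S_def)
  qed
  then have "\<P>(\<omega> in ?M. 16 * real n < (\<Sum>j<n. (\<omega> (i, j) / \<sigma>) ^ 4)) \<le> prob ((\<Union>j<n. U j) \<union> S)"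
    using S U by (intro finite_measure_mono) auto
  also have "\<dots> \<le> prob (\<Union>j<n. U j) + prob S"
    using S U by (intro measure_Un_le) auto
  also have "prob (\<Union>j<n. U j) \<le> (\<Sum>j<n. prob (U j))"
    using U by (intro measure_UNION_le) auto
  also have "\<dots> \<le> n * (2 * exp (- L\<^sup>2 / 2))"
    using sum_bounded_above[of "{..<n}" "\<lambda>j. prob (U j)", OF prob_U] by simp
  finally show ?thesis using prob_S by simp
qed

section \<open>Discrepancy of the perturbed matrix\<close>

lemma linf_norm_le_iff:
  assumes "0 \<le> D"
  shows "linf_norm v \<le> D \<longleftrightarrow> (\<forall>i<dim_vec v. \<bar>v $ i\<bar> \<le> D)"
  using assms by (auto simp: linf_norm_def)

lemma disc_le_iff:
  assumes A: "A \<in> carrier_mat m n" and "0 \<le> D"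
  shows "disc A \<le> D \<longleftrightarrow> (\<exists>x\<in>sign_vecs n. \<forall>i<m. \<bar>\<Sum>j<n. A $$ (i, j) * x $ j\<bar> \<le> D)"
proof -
  have "disc A \<le> D \<longleftrightarrow> (\<exists>x\<in>sign_vecs n. linf_norm (A *\<^sub>v x) \<le> D)"
    using A finite_sign_vecs sign_vecs_nonempty by (simp add: disc_def Min_le_iff)
  also have "\<dots> \<longleftrightarrow> (\<exists>x\<in>sign_vecs n. \<forall>i<m. \<bar>\<Sum>j<n. A $$ (i, j) * x $ j\<bar> \<le> D)"
    using A assms(2)
    by (intro bex_cong refl) (auto simp: linf_norm_le_iff scalar_prod_def sign_vecs_def lessThan_atLeast0)
  finally show ?thesis .
qed

lemma sum_squares_column_le:
  assumes C: "C \<in> carrier_mat m n" and "j < n" "l2_norm (col C j) \<le> 1"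
  shows "(\<Sum>i<m. (C $$ (i, j))\<^sup>2) \<le> 1"
proof -
  have "sqrt (\<Sum>i<m. (C $$ (i, j))\<^sup>2) \<le> 1"
    using assms by (simp add: l2_norm_def L2_set_def)
  then show ?thesis by simp
qed

text \<open>The event is a finite union over signings of finite intersections of measurable row
  conditions.\<close>

lemma sets_disc_le:
  assumes C: "C \<in> carrier_mat m n" and "0 \<le> D"
  shows "{\<omega>\<in>space (gaussian_array m n \<sigma>). disc (C + mat m n \<omega>) \<le> D} \<in> sets (gaussian_array m n \<sigma>)"
proof -
  let ?M = "gaussian_array m n \<sigma>"
  have "disc (C + mat m n \<omega>) \<le> D
      \<longleftrightarrow> (\<exists>x\<in>sign_vecs n. \<forall>i\<in>{..<m}. \<bar>\<Sum>j<n. (C $$ (i, j) + \<omega> (i, j)) * x $ j\<bar> \<le> D)" for \<omega>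
    using C by (subst disc_le_iff[OF _ assms(2), of _ m n]) auto
  moreover have "{\<omega>\<in>space ?M. \<exists>x\<in>sign_vecs n. \<forall>i\<in>{..<m}. \<bar>\<Sum>j<n. (C $$ (i, j) + \<omega> (i, j)) * x $ j\<bar> \<le> D}
      \<in> sets ?M"
  proof (intro sets.sets_Collect_finite_Ex sets.sets_Collect_finite_All finite_sign_vecs finite_lessThan)
    fix x :: "real vec" and i assume "i \<in> {..<m}"
    then have [measurable]: "(\<lambda>\<omega>. \<Sum>j<n. (C $$ (i, j) + \<omega> (i, j)) * x $ j) \<in> borel_measurable ?M"
      by (intro borel_measurable_sum borel_measurable_times borel_measurable_add) auto
    show "{\<omega>\<in>space ?M. \<bar>\<Sum>j<n. (C $$ (i, j) + \<omega> (i, j)) * x $ j\<bar> \<le> D} \<in> sets ?M" by measurable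
  qed
  ultimately show ?thesis by simp
qed

text \<open>With \<open>G = 0\<close> the signing depends on \<open>C\<close> alone; with
  \<open>G\<close> the rescaled noise it depends on both matrices.\<close>

lemma signing_exists:
  fixes G :: "nat \<Rightarrow> nat \<Rightarrow> real"
  assumes C: "C \<in> carrier_mat m n" "\<forall>j<n. l2_norm (col C j) \<le> 1" and "2 \<le> n" "n \<le> m"
    and G: "\<And>i. i < m \<Longrightarrow> (\<Sum>j<n. (G i j)^4) \<le> 16 * real n"
  shows "\<exists>x\<in>sign_vecs n. \<forall>i<m. \<bar>\<Sum>j<n. C $$ (i, j) * x $ j\<bar> \<le> 14 * sqrt (ln n)
    \<and> \<bar>\<Sum>j<n. G i j * x $ j\<bar> \<le> 180 * sqrt (n * ln (2 * real m / n))"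
proof -
  interpret bounded_columns n "{..<m}" "\<lambda>i j. C $$ (i, j)" "sqrt (ln n)"
    using assms sum_squares_column_le[OF C(1)] by unfold_locales auto
  obtain x :: "nat \<Rightarrow> real" where "\<forall>j<n. x j \<in> {-1, 1}"
      "\<forall>i\<in>{..<m}. \<bar>\<Sum>j<n. C $$ (i, j) * x j\<bar> \<le> 14 * sqrt (ln n)"
      "\<forall>i\<in>{..<m}. \<bar>\<Sum>j<n. G i j * x j\<bar> \<le> 180 * sqrt (n * ln (2 * card {..<m} / n))"
    using full_colouring[where G = G and J = "{..<m}"] assms by auto
  then show ?thesis
    by (intro bexI[of _ "vec n x"]) (auto simp: sign_vecs_def)
qed

lemma (in prob_space) prob_ge_of_bad_event:
  assumes "{\<omega>\<in>space M. P \<omega>} \<in> events" "B \<in> events" "prob B \<le> e"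
    and "\<And>\<omega>. \<omega> \<in> space M \<Longrightarrow> \<omega> \<notin> B \<Longrightarrow> P \<omega>"
  shows "1 - e \<le> \<P>(\<omega> in M. P \<omega>)"
proof -
  have "1 - e \<le> prob (space M - B)" using assms by (simp add: prob_compl)
  also have "\<dots> \<le> \<P>(\<omega> in M. P \<omega>)" using assms by (intro finite_measure_mono) auto
  finally show ?thesis .
qed

lemma (in prob_space) prob_bex_le:
  assumes "\<And>i. i < m \<Longrightarrow> {\<omega>\<in>space M. P i \<omega>} \<in> events"
    and "\<And>i. i < (m::nat) \<Longrightarrow> \<P>(\<omega> in M. P i \<omega>) \<le> e"
  shows "{\<omega>\<in>space M. \<exists>i<m. P i \<omega>} \<in> events" "\<P>(\<omega> in M. \<exists>i<m. P i \<omega>) \<le> m * e"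
proof -
  have eq: "{\<omega>\<in>space M. \<exists>i<m. P i \<omega>} = (\<Union>i<m. {\<omega>\<in>space M. P i \<omega>})" by auto
  show "{\<omega>\<in>space M. \<exists>i<m. P i \<omega>} \<in> events" unfolding eq using assms(1) by auto
  have "\<P>(\<omega> in M. \<exists>i<m. P i \<omega>) \<le> (\<Sum>i<m. \<P>(\<omega> in M. P i \<omega>))"
    unfolding eq using assms(1) by (intro measure_UNION_le) auto
  also have "\<dots> \<le> m * e"
    using sum_bounded_above[of "{..<m}" "\<lambda>i. \<P>(\<omega> in M. P i \<omega>)", OF assms(2)] by simp
  finally show "\<P>(\<omega> in M. \<exists>i<m. P i \<omega>) \<le> m * e" .
qed

section \<open>The three noise regimes: none, more than \<open>n^2\<close> rows, at most
  \<open>n^2\<close> rows\<close>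

context
  fixes m n :: nat and C :: "real mat" and \<sigma> :: real
  assumes C: "C \<in> carrier_mat m n" "\<forall>j<n. l2_norm (col C j) \<le> 1"
    and n: "2 \<le> n" "n \<le> m"
begin

abbreviation (input) bound :: real where
  "bound \<equiv> 180 * (sqrt (ln n) + \<sigma> * sqrt (n * ln (2 * real m / n)))"

lemma bound_nonneg: "0 \<le> \<sigma> \<Longrightarrow> 0 \<le> bound"
  using n by (intro mult_nonneg_nonneg add_nonneg_nonneg) (auto simp: field_simps)

lemma disc_le_of_signing:
  assumes "0 \<le> \<sigma>" "x \<in> sign_vecs n"
    and "\<And>i. i < m \<Longrightarrow> \<bar>\<Sum>j<n. C $$ (i, j) * x $ j\<bar> \<le> 14 * sqrt (ln n)"
    and "\<And>i. i < m \<Longrightarrow> \<bar>\<Sum>j<n. \<omega> (i, j) * x $ j\<bar> \<le> \<sigma> * (180 * sqrt (n * ln (2 * real m / n)))"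
  shows "disc (C + mat m n \<omega>) \<le> bound"
proof -
  have "\<bar>\<Sum>j<n. (C + mat m n \<omega>) $$ (i, j) * x $ j\<bar> \<le> bound" if "i < m" for i
  proof -
    have "(\<Sum>j<n. (C + mat m n \<omega>) $$ (i, j) * x $ j)
        = (\<Sum>j<n. C $$ (i, j) * x $ j) + (\<Sum>j<n. \<omega> (i, j) * x $ j)"
      using C(1) that by (simp add: sum.distrib[symmetric] distrib_right)
    then have "\<bar>\<Sum>j<n. (C + mat m n \<omega>) $$ (i, j) * x $ j\<bar>
        \<le> 14 * sqrt (ln n) + \<sigma> * (180 * sqrt (n * ln (2 * real m / n)))"
      using assms(3,4)[OF that] by linarith
    also have "\<dots> \<le> bound" using n by (simp add: algebra_simps)
    finally show ?thesis .
  qed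
  then show ?thesis
    using assms(2) C(1) by (subst disc_le_iff[OF _ bound_nonneg[OF assms(1)], of _ m n]) auto
qed

lemma prob_disc_le_no_noise:
  assumes "\<sigma> = 0"
  shows "\<P>(\<omega> in gaussian_array m n \<sigma>. disc (C + mat m n \<omega>) \<le> bound) = 1"
proof -
  let ?M = "gaussian_array m n \<sigma>"
  interpret prob_space ?M using assms by (intro prob_space_gaussian_array) simp
  obtain x where x: "x \<in> sign_vecs n" "\<And>i. i < m \<Longrightarrow> \<bar>\<Sum>j<n. C $$ (i, j) * x $ j\<bar> \<le> 14 * sqrt (ln n)"
    using signing_exists[OF C n, of "\<lambda>_ _. 0"] by auto
  have "AE \<omega> in ?M. \<forall>p\<in>{..<m} \<times> {..<n}. \<omega> p = 0"
  proof (intro AE_finite_allI)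
    fix p assume "p \<in> {..<m} \<times> {..<n}"
    moreover have "AE y in centred_normal \<sigma>. y = 0"
    proof -
      have "centred_normal \<sigma> = return borel 0" using assms by (simp add: centred_normal_def)
      then show ?thesis by (simp only:) (subst AE_return, auto)
    qed
    ultimately show "AE \<omega> in ?M. \<omega> p = 0"
      unfolding gaussian_array_def using assms
      by (intro AE_PiM_component prob_space_centred_normal) auto
  qed simp
  then have "AE \<omega> in ?M. disc (C + mat m n \<omega>) \<le> bound"
  proof (rule AE_mp, intro AE_I2 impI)
    fix \<omega> :: "nat \<times> nat \<Rightarrow> real" assume "\<forall>p\<in>{..<m} \<times> {..<n}. \<omega> p = 0"
    then show "disc (C + mat m n \<omega>) \<le> bound"
      using x assms by (intro disc_le_of_signing[of x]) auto
  qed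
  then show ?thesis
    using sets_disc_le[OF C(1) bound_nonneg, of \<sigma>] assms by (subst prob_Collect_eq_1) auto
qed

text \<open>The signing is fixed before the noise, so each row of the noise is tested against one
  fixed vector. As \<open>n^2 < m\<close>, the logarithm in the bound is at least half of
  \<open>ln m\<close>, enough for a union bound over the rows.\<close>

lemma prob_disc_le_many_rows:
  assumes "0 < \<sigma>" "n\<^sup>2 < m"
  shows "1 - 1 / (real m)\<^sup>2 \<le> \<P>(\<omega> in gaussian_array m n \<sigma>. disc (C + mat m n \<omega>) \<le> bound)"
proof -
  let ?M = "gaussian_array m n \<sigma>"
  interpret prob_space ?M using assms by (intro prob_space_gaussian_array) simp
  obtain x where x: "x \<in> sign_vecs n" "\<And>i. i < m \<Longrightarrow> \<bar>\<Sum>j<n. C $$ (i, j) * x $ j\<bar> \<le> 14 * sqrt (ln n)"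
    using signing_exists[OF C n, of "\<lambda>_ _. 0"] by auto
  define L where "L = ln (2 * real m / n)"
  have arg: "0 < 2 * real m / n" using n by simp
  have L: "0 \<le> L" unfolding L_def using n by (intro ln_ge_zero) (auto simp: field_simps)
  \<comment> \<open>The factor 4 makes the Gaussian exponent \<open>- 8 * L\<close>, and
    \<open>m \<le> (2 * m / n)^2\<close> then gives a tail of at most \<open>2 / m ^ 4\<close> per
    row.\<close>
  define t where "t = 4 * \<sigma> * sqrt (n * L)"
  have t: "0 \<le> t" using assms L by (simp add: t_def)
  have norm_x: "(\<Sum>j<n. (x $ j)\<^sup>2) = n"
  proof -
    have "(\<Sum>j<n. (x $ j)\<^sup>2) = (\<Sum>j<n. 1)"
      using x(1) by (intro sum.cong) (auto simp: sign_vecs_def power2_eq_1_iff)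
    then show ?thesis by simp
  qed
  have exponent: "- t\<^sup>2 / (2 * \<sigma>\<^sup>2 * n) = - (8 * L)"
    using assms n L by (simp add: t_def power_mult_distrib field_simps)
  have tail: "\<P>(\<omega> in ?M. t \<le> \<bar>\<Sum>j<n. x $ j * \<omega> (i, j)\<bar>) \<le> 2 / m ^ 4" if "i < m" for i
  proof -
    have "\<P>(\<omega> in ?M. t \<le> \<bar>\<Sum>j<n. x $ j * \<omega> (i, j)\<bar>) \<le> 2 * exp (- t\<^sup>2 / (2 * \<sigma>\<^sup>2 * n))"
      using assms n t norm_x that by (intro gaussian_array_row_tail) auto
    also have "exp (- t\<^sup>2 / (2 * \<sigma>\<^sup>2 * n)) = exp (- (8 * L))" by (simp only: exponent)
    also have "\<dots> = 1 / (2 * real m / n) ^ 8"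
      using arg exp_of_nat_mult[of 8 L] by (simp add: exp_minus L_def inverse_eq_divide)
    also have "\<dots> \<le> 1 / m ^ 4"
    proof -
      have "real m * (real n)\<^sup>2 \<le> real m * real m"
        using assms(2) by (intro mult_left_mono) (simp_all flip: of_nat_power)
      also have "\<dots> \<le> (2 * real m)\<^sup>2" by (simp add: power2_eq_square)
      finally have "real m \<le> (2 * real m / n)\<^sup>2"
        using n by (simp add: power_divide pos_le_divide_eq)
      then have "real m ^ 4 \<le> ((2 * real m / n)\<^sup>2) ^ 4" by (intro power_mono) auto
      also have "\<dots> = (2 * real m / n) ^ 8" by (simp only: power_mult[symmetric]) simp
      finally have "real m ^ 4 \<le> (2 * real m / n) ^ 8" .
      then show ?thesis using n by (intro divide_left_mono) auto
    qed
    finally show ?thesis by simp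
  qed
  have meas: "{\<omega>\<in>space ?M. t \<le> \<bar>\<Sum>j<n. x $ j * \<omega> (i, j)\<bar>} \<in> events" if "i < m" for i
  proof -
    have [measurable]: "(\<lambda>\<omega>. \<Sum>j<n. x $ j * \<omega> (i, j)) \<in> borel_measurable ?M"
      using that by (intro borel_measurable_sum borel_measurable_times) auto
    show ?thesis by measurable
  qed
  show ?thesis
  proof (rule prob_ge_of_bad_event[OF sets_disc_le[OF C(1) bound_nonneg] prob_bex_le(1)[OF meas tail]])
    have "\<P>(\<omega> in ?M. \<exists>i<m. t \<le> \<bar>\<Sum>j<n. x $ j * \<omega> (i, j)\<bar>) \<le> m * (2 / m ^ 4)"
      by (rule prob_bex_le(2)[OF meas tail])
    also have "\<dots> \<le> 1 / (real m)\<^sup>2"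
      using n by (simp add: field_simps eval_nat_numeral)
    finally show "\<P>(\<omega> in ?M. \<exists>i<m. t \<le> \<bar>\<Sum>j<n. x $ j * \<omega> (i, j)\<bar>) \<le> 1 / (real m)\<^sup>2" .
  next
    fix \<omega> assume \<omega>: "\<omega> \<in> space ?M" "\<omega> \<notin> {\<omega>\<in>space ?M. \<exists>i<m. t \<le> \<bar>\<Sum>j<n. x $ j * \<omega> (i, j)\<bar>}"
    have "\<bar>\<Sum>j<n. \<omega> (i, j) * x $ j\<bar> \<le> \<sigma> * (180 * sqrt (n * ln (2 * real m / n)))" if "i < m" for i
    proof -
      have "\<bar>\<Sum>j<n. \<omega> (i, j) * x $ j\<bar> < t" using \<omega> that by (auto simp: mult.commute not_le)
      also have "t = \<sigma> * (4 * sqrt (n * L))" by (simp add: t_def)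
      also have "\<dots> \<le> \<sigma> * (180 * sqrt (n * L))"
        using assms L by (intro mult_left_mono mult_right_mono) auto
      finally show ?thesis by (simp add: L_def)
    qed
    then show "disc (C + mat m n \<omega>) \<le> bound"
      using assms x by (intro disc_le_of_signing[of x]) auto
  qed (use assms in simp_all)
qed

text \<open>Off the event that some rescaled row violates the fourth-power bound, the deterministic
  signing applies. The assumption \<open>large\<close> is the union bound:
  \<open>m ^ 3 \<le> n ^ 6\<close> covers both the \<open>m\<close> rows and the target
  \<open>1 / m^2\<close>.\<close>

lemma prob_disc_le_few_rows:
  assumes "0 < \<sigma>" "m \<le> n\<^sup>2"
    and large: "real n ^ 6 * (2 * n * exp (- (9 * ln n)) + exp (- 10 * n / (324 * (ln n)\<^sup>2))) \<le> 1"
  shows "1 - 1 / (real m)\<^sup>2 \<le> \<P>(\<omega> in gaussian_array m n \<sigma>. disc (C + mat m n \<omega>) \<le> bound)"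
proof -
  let ?M = "gaussian_array m n \<sigma>"
  interpret prob_space ?M using assms by (intro prob_space_gaussian_array) simp
  \<comment> \<open>This level makes the truncation failure of one row at most
    \<open>2 * n * exp (- 9 * ln n)\<close>, of order \<open>n\<close> to the power -8.\<close>
  define L where "L = sqrt (18 * ln n)"
  define e where "e = 2 * real n * exp (- (9 * ln n)) + exp (- 10 * n / (324 * (ln n)\<^sup>2))"
  have ln_n: "0 < ln (real n)" using n by simp
  have L: "0 < L" "L\<^sup>2 = 18 * ln n" using ln_n by (simp_all add: L_def)
  have L4: "L ^ 4 = 324 * (ln n)\<^sup>2"
  proof -
    have "L ^ 4 = (L\<^sup>2)\<^sup>2" by simp
    then show ?thesis unfolding L(2) by (simp add: power_mult_distrib)
  qed
  have tail: "\<P>(\<omega> in ?M. 16 * real n < (\<Sum>j<n. (\<omega> (i, j) / \<sigma>) ^ 4)) \<le> e" if "i < m" for i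
    using gaussian_array_row_fourth_powers[OF assms(1) that L(1), of n] by (simp add: L(2) L4 e_def)
  have meas: "{\<omega>\<in>space ?M. 16 * real n < (\<Sum>j<n. (\<omega> (i, j) / \<sigma>) ^ 4)} \<in> events" if "i < m" for i
  proof -
    have [measurable]: "(\<lambda>\<omega>. \<Sum>j<n. (\<omega> (i, j) / \<sigma>) ^ 4) \<in> borel_measurable ?M"
      using that by (intro borel_measurable_sum borel_measurable_power borel_measurable_divide) auto
    show ?thesis by measurable
  qed
  show ?thesis
  proof (rule prob_ge_of_bad_event[OF sets_disc_le[OF C(1) bound_nonneg] prob_bex_le(1)[OF meas tail]])
    have "real m ^ 3 * e \<le> real n ^ 6 * e"
    proof (intro mult_right_mono)
      have "real m ^ 3 \<le> ((real n)\<^sup>2) ^ 3"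
        using assms(2) by (intro power_mono) (simp_all flip: of_nat_power)
      then show "real m ^ 3 \<le> real n ^ 6" by (simp only: power_mult[symmetric]) simp
    qed (simp add: e_def)
    also have "\<dots> \<le> 1" using large by (simp add: e_def)
    finally have "m * e \<le> 1 / (real m)\<^sup>2"
      using n by (simp add: field_simps eval_nat_numeral)
    moreover have "\<P>(\<omega> in ?M. \<exists>i<m. 16 * real n < (\<Sum>j<n. (\<omega> (i, j) / \<sigma>) ^ 4)) \<le> m * e"
      by (rule prob_bex_le(2)[OF meas tail])
    ultimately show "\<P>(\<omega> in ?M. \<exists>i<m. 16 * real n < (\<Sum>j<n. (\<omega> (i, j) / \<sigma>) ^ 4)) \<le> 1 / (real m)\<^sup>2"
      by linarith
  next
    fix \<omega> assume \<omega>: "\<omega> \<in> space ?M"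
      "\<omega> \<notin> {\<omega>\<in>space ?M. \<exists>i<m. 16 * real n < (\<Sum>j<n. (\<omega> (i, j) / \<sigma>) ^ 4)}"
    then have "(\<Sum>j<n. (\<omega> (i, j) / \<sigma>) ^ 4) \<le> 16 * real n" if "i < m" for i
      using that by (force simp: not_less)
    from signing_exists[where G = "\<lambda>i j. \<omega> (i, j) / \<sigma>", OF C n this]
    obtain x where x: "x \<in> sign_vecs n" "\<And>i. i < m \<Longrightarrow> \<bar>\<Sum>j<n. C $$ (i, j) * x $ j\<bar> \<le> 14 * sqrt (ln n)"
      and scaled: "\<And>i. i < m \<Longrightarrow> \<bar>\<Sum>j<n. \<omega> (i, j) / \<sigma> * x $ j\<bar> \<le> 180 * sqrt (n * ln (2 * real m / n))"
      by blast
    have "\<bar>\<Sum>j<n. \<omega> (i, j) * x $ j\<bar> \<le> \<sigma> * (180 * sqrt (n * ln (2 * real m / n)))" if "i < m" for i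
    proof -
      have "(\<Sum>j<n. \<omega> (i, j) * x $ j) = \<sigma> * (\<Sum>j<n. \<omega> (i, j) / \<sigma> * x $ j)"
        using assms(1) by (simp add: sum_distrib_left)
      then have "\<bar>\<Sum>j<n. \<omega> (i, j) * x $ j\<bar> = \<sigma> * \<bar>\<Sum>j<n. \<omega> (i, j) / \<sigma> * x $ j\<bar>"
        using assms(1) by (simp add: abs_mult)
      then show ?thesis using assms(1) scaled[OF that] by simp
    qed
    then show "disc (C + mat m n \<omega>) \<le> bound"
      using assms x by (intro disc_le_of_signing[of x]) auto
  qed (use assms in simp_all)
qed

end

theorem theorem5:
  "\<exists>c>0. \<exists>K>0. \<forall>(m::nat) (n::nat) (\<sigma>::real) (C::real mat).
     0 < n \<longrightarrow> n \<le> m \<longrightarrow> real m \<le> 2 powr (c * sqrt (real n)) \<longrightarrow> 0 \<le> \<sigma> \<longrightarrow>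
     C \<in> carrier_mat m n \<longrightarrow> (\<forall>j<n. l2_norm (col C j) \<le> 1) \<longrightarrow>
     \<P>(\<omega> in gaussian_array m n \<sigma>.
        disc (C + mat m n \<omega>)
          \<le> K * (sqrt (ln (real n)) + \<sigma> * sqrt (real n * ln (2 * real m / real n))))
       \<ge> 1 - 1 / (real m)\<^sup>2"
proof -
  \<comment> \<open>The first summand is \<open>2 / x^2\<close>; in the second,
    \<open>x / (ln x)^2\<close> outgrows \<open>6 * ln x\<close>.\<close>
  have "((\<lambda>x::real. x ^ 6 * (2 * x * exp (- (9 * ln x)) + exp (- 10 * x / (324 * (ln x)\<^sup>2)))) \<longlongrightarrow> 0) at_top"
    by real_asymp
  then have "\<forall>\<^sub>F x in at_top. x ^ 6 * (2 * x * exp (- (9 * ln x)) + exp (- 10 * x / (324 * (ln x)\<^sup>2))) < (1::real)"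
    by (rule order_tendstoD(2)) simp
  then obtain X :: real where X:
    "\<And>x. X \<le> x \<Longrightarrow> x ^ 6 * (2 * x * exp (- (9 * ln x)) + exp (- 10 * x / (324 * (ln x)\<^sup>2))) < 1"
    by (auto simp: eventually_at_top_linorder)
  \<comment> \<open>With \<open>c = 1 / sqrt N\<close>, any \<open>m\<close> of at least 2 forces
    \<open>1 \<le> c * sqrt n\<close>, that is \<open>N \<le> n\<close>.\<close>
  define N where "N = max X 2"
  have N: "2 \<le> N" "X \<le> N" by (simp_all add: N_def)
  have main: "1 - 1 / (real m)\<^sup>2 \<le> \<P>(\<omega> in gaussian_array m n \<sigma>. disc (C + mat m n \<omega>)
      \<le> 180 * (sqrt (ln (real n)) + \<sigma> * sqrt (real n * ln (2 * real m / real n))))"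
    if "0 < n" "n \<le> m" and m_le: "real m \<le> 2 powr (1 / sqrt N * sqrt (real n))" and "0 \<le> \<sigma>"
      and C: "C \<in> carrier_mat m n" "\<forall>j<n. l2_norm (col C j) \<le> 1" for m n \<sigma> C
  proof (cases "m = 1")
    case True
    \<comment> \<open>For a single row the claimed lower bound \<open>1 - 1 / m^2\<close> is
      0.\<close>
    then show ?thesis by simp
  next
    case False
    then have "2 powr 1 \<le> real m" using that(1,2) by simp
    also note m_le
    finally have "1 \<le> 1 / sqrt N * sqrt (real n)" by (subst (asm) powr_le_cancel_iff) auto
    then have "sqrt N \<le> sqrt n" using N by (simp add: field_simps)
    then have Nn: "N \<le> n" by simp
    then have n: "2 \<le> n" using N by simp
    consider "\<sigma> = 0" | "0 < \<sigma>" "n\<^sup>2 < m" | "0 < \<sigma>" "m \<le> n\<^sup>2"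
      using \<open>0 \<le> \<sigma>\<close> by linarith
    then show ?thesis
    proof cases
      case 1
      then show ?thesis using prob_disc_le_no_noise[OF C n that(2)] by simp
    next
      case 2
      then show ?thesis by (rule prob_disc_le_many_rows[OF C n that(2)])
    next
      case 3
      then show ?thesis
        using X[of n] N Nn by (intro prob_disc_le_few_rows[OF C n that(2)]) auto
    qed
  qed
  show ?thesis
    using N main by (intro exI[of _ "1 / sqrt N"] conjI exI[of _ "180 :: real"] allI impI) auto
qed

end
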